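(* Let $\ell$ be a positive integer with at least two distinct odd prime factors, and let $\omega$ be the number of distinct prime factors of $\ell$. Let $P^*_{\mathrm{odd}}(\ell)$ be the set of all odd primes dividing $\ell$ except for the smallest such prime, and set $\varepsilon=\frac{1}{20}\sum_{p\in P^*_{\mathrm{odd}}(\ell)} p^{-2}$. Then there is $n_0=n_0(\ell)$ such that for all $n\geq n_0$, \[ f_{\ell}(n)\leq \omega n-(2\omega+\varepsilon)\log_2 n . \]
   Context: For a positive integer $\ell$, an $\ell$-Oddtown on $[n]=\{1,\dots,n\}$ is a family $\mathcal{A}$ of subsets of $[n]$ such that $|A|\not\equiv 0 \pmod{\ell}$ for every $A\in\mathcal{A}$ and $|A\cap B|\equiv 0\pmod{\ell}$ for all distinct $A,B\in\mathcal{A}$. $f_\ell(n)$ denotes the maximum size of an $\ell$-Oddtown on $[n]$. *)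

theory Defs
  imports Complex_Main "HOL-Computational_Algebra.Primes"
begin

definition oddtown :: "nat \<Rightarrow> nat \<Rightarrow> nat set set \<Rightarrow> bool" where
  "oddtown l n F \<longleftrightarrow>
     (\<forall>A\<in>F. A \<subseteq> {1..n}) \<and>
     (\<forall>A\<in>F. card A mod l \<noteq> 0) \<and>
     (\<forall>A\<in>F. \<forall>B\<in>F. A \<noteq> B \<longrightarrow> card (A \<inter> B) mod l = 0)"

text \<open>Maximum size of an l-Oddtown on {1..n} (families are finite, being subsets of Pow {1..n}).\<close>
definition f_odd :: "nat \<Rightarrow> nat \<Rightarrow> nat" where
  "f_odd l n = Max {card F | F. oddtown l n F}"

definition P_odd_star :: "nat \<Rightarrow> nat set" where
  "P_odd_star l = {p. prime p \<and> odd p \<and> p dvd l} - {Min {p. prime p \<and> odd p \<and> p dvd l}}"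

end

theory Submission
  imports Defs "HOL-Number_Theory.Cong" "HOL-Analysis.Convex" "HOL-Real_Asymp.Real_Asymp"
begin

text \<open>
  For a prime \<open>p\<close> with \<open>p ^ a\<close> the exact power dividing \<open>l\<close>, let \<open>F_p\<close> be the sets of the Oddtown \<open>F\<close> whose size
  is not divisible by \<open>p ^ a\<close>; these cover \<open>F\<close>. The remaining sets \<open>G = F - F_p\<close> are isotropic and orthogonal
  to \<open>F_p\<close> modulo \<open>p ^ a\<close>, so if their characteristic vectors have rank \<open>d\<close> modulo \<open>p\<close>, then
  \<open>card F_p + 2 d \<le> n\<close>. A member of \<open>G\<close> is determined by \<open>d\<close> of its coordinates, whence \<open>card G \<le> 2 ^ d\<close>; as
  \<open>card G\<close> is at least about \<open>n\<close>, this yields the term \<open>2 \<omega> log n\<close>.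

  For odd \<open>p\<close> the bound \<open>2 ^ d\<close> can be improved to roughly \<open>2 ^ (16 d / 17)\<close>. Regard the coordinates as linear
  functionals on the \<open>d\<close> pivots, and take \<open>k\<close> maximal such that some \<open>k\<close> coordinates have invertible
  matrices on two disjoint blocks of \<open>k\<close> pivots. Since all values are 0 or 1, an additive energy estimate
  bounds \<open>card G\<close> by \<open>2 ^ d * (3/4) ^ (k/2)\<close>. Conversely, once the \<open>2 k\<close> pivots and the \<open>k\<close> coordinates
  are fixed, maximality forces every other coordinate to depend on a single pivot; such a subfamily lies
  in an affine space of dimension \<open>d\<close> over the rationals, and the Oddtown property for the other primes
  bounds it by \<open>\<omega> (d + 1)\<close>, so \<open>card G \<le> 8 ^ k * \<omega> (d + 1)\<close>. The improvement does not
  depend on \<open>p\<close>, so it exceeds the sum in the theorem.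
\<close>

section \<open>Integer relations and elimination modulo a prime\<close>

text \<open>Gaussian elimination without division, one column at a time: a pivot row
  \<open>k\<close> with \<open>M k e \<noteq> 0\<close> is used to clear column \<open>e\<close> by
  cross-multiplication, so everything stays in the integers.\<close>

lemma exists_int_relation:
  fixes M :: "'a \<Rightarrow> 'b \<Rightarrow> int"
  assumes "finite N" "finite J" "card N < card J"
  shows "\<exists>x. (\<forall>e\<in>N. (\<Sum>j\<in>J. x j * M j e) = 0) \<and> (\<exists>j\<in>J. x j \<noteq> 0)"
  using assms
proof (induction N arbitrary: J M rule: finite_induct)
  case empty
  then have "J \<noteq> {}" by auto
  then show ?case by (intro exI[of _ "\<lambda>_. 1"]) auto
next
  case (insert e N)
  show ?case
  proof (cases "\<forall>j\<in>J. M j e = 0")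
    case True
    have "card N < card J" using insert by simp
    from insert.IH[OF insert.prems(1) this, of M] obtain x where
      "\<forall>e\<in>N. (\<Sum>j\<in>J. x j * M j e) = 0" "\<exists>j\<in>J. x j \<noteq> 0" by blast
    moreover have "(\<Sum>j\<in>J. x j * M j e) = 0" using True by (intro sum.neutral) auto
    ultimately show ?thesis by auto
  next
    case False
    then obtain k where k: "k \<in> J" "M k e \<noteq> 0" by blast
    have "card N < card (J - {k})" using insert k by simp
    from insert.IH[OF _ this, of "\<lambda>j f. M k e * M j f - M j e * M k f"] insert.prems
    obtain x where x: "\<And>f. f \<in> N \<Longrightarrow> (\<Sum>j\<in>J-{k}. x j * (M k e * M j f - M j e * M k f)) = 0"
      and nz: "\<exists>j\<in>J-{k}. x j \<noteq> 0" by auto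
    \<comment> \<open>The coefficient at \<open>k\<close> is chosen so that the relation
      \<open>x\<close> between the cleared rows unfolds to a relation between the original
      rows.\<close>
    define y where "y = (\<lambda>j. if j = k then - (\<Sum>j\<in>J-{k}. x j * M j e) else x j * M k e)"
    have split: "(\<Sum>j\<in>J. y j * M j f) =
        (\<Sum>j\<in>J-{k}. x j * (M k e * M j f - M j e * M k f))" for f
    proof -
      have "(\<Sum>j\<in>J. y j * M j f) = y k * M k f + (\<Sum>j\<in>J-{k}. y j * M j f)"
        using k insert.prems by (simp add: sum.remove)
      also have "(\<Sum>j\<in>J-{k}. y j * M j f) = (\<Sum>j\<in>J-{k}. x j * M k e * M j f)"
        by (intro sum.cong) (auto simp: y_def)
      also have "y k * M k f = (\<Sum>j\<in>J-{k}. - (x j * M j e * M k f))"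
        by (simp add: y_def sum_distrib_right sum_negf)
      finally show ?thesis by (simp add: sum.distrib[symmetric] algebra_simps)
    qed
    have "(\<Sum>j\<in>J. y j * M j f) = 0" if "f \<in> insert e N" for f
    proof (cases "f = e")
      case True
      then show ?thesis unfolding split by (simp add: mult.commute)
    next
      case False
      then show ?thesis unfolding split using x that by simp
    qed
    moreover have "\<exists>j\<in>J. y j \<noteq> 0" using nz k by (auto simp: y_def)
    ultimately show ?thesis by blast
  qed
qed

text \<open>A nonzero relation minimising the sum \<open>m\<close> of absolute values is primitive
  at \<open>p\<close>, since otherwise dividing it by \<open>p\<close> would make it smaller. An
  exact integer relation can be read modulo any power \<open>p ^ a\<close>, which a relation modulo
  \<open>p\<close> could not.\<close>

lemma exists_primitive_int_relation:
  fixes M :: "'a \<Rightarrow> 'b \<Rightarrow> int" and p :: int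
  assumes "prime p" "finite N" "finite J" "card N < card J"
  shows "\<exists>x. (\<forall>e\<in>N. (\<Sum>j\<in>J. x j * M j e) = 0) \<and> (\<exists>j\<in>J. \<not> p dvd x j)"
proof -
  define P where "P x \<longleftrightarrow> (\<forall>e\<in>N. (\<Sum>j\<in>J. x j * M j e) = 0) \<and> (\<exists>j\<in>J. x j \<noteq> 0)" for x
  define m where "m x = (\<Sum>j\<in>J. nat \<bar>x j\<bar>)" for x :: "'a \<Rightarrow> int"
  have p: "p > 1" using assms(1) prime_gt_1_int by blast
  obtain x0 where "P x0"
    using exists_int_relation[OF assms(2-4), of M] unfolding P_def by auto
  then obtain x where x: "P x" "\<And>y. P y \<Longrightarrow> m x \<le> m y"
    using ex_has_least_nat[of P x0 m] by auto
  have "\<exists>j\<in>J. \<not> p dvd x j"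
  proof (rule ccontr)
    assume "\<not> ?thesis"
    then have d: "x j = p * (x j div p)" if "j \<in> J" for j using that by auto
    define y where "y j = x j div p" for j
    have xy: "x j = p * y j" if "j \<in> J" for j using d that unfolding y_def by blast
    have "p * (\<Sum>j\<in>J. y j * M j e) = (\<Sum>j\<in>J. x j * M j e)" for e
      unfolding sum_distrib_left by (intro sum.cong) (auto simp: xy)
    moreover have "(\<Sum>j\<in>J. x j * M j e) = 0" if "e \<in> N" for e
      using x(1) that unfolding P_def by blast
    ultimately have "p * (\<Sum>j\<in>J. y j * M j e) = 0" if "e \<in> N" for e
      using that by metis
    then have "(\<Sum>j\<in>J. y j * M j e) = 0" if "e \<in> N" for e
      using that p by fastforce
    moreover from x(1) obtain k where k: "k \<in> J" "x k \<noteq> 0" unfolding P_def by blast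
    then have yk: "y k \<noteq> 0" using xy by auto
    ultimately have "P y" unfolding P_def using k by blast
    have le: "\<bar>y j\<bar> \<le> \<bar>x j\<bar>" if "j \<in> J" for j
      using xy[OF that] p mult_right_mono[of 1 p "\<bar>y j\<bar>"] by (simp add: abs_mult)
    have lt: "\<bar>y k\<bar> < \<bar>x k\<bar>"
      using xy[OF k(1)] p yk by (simp add: abs_mult)
    have "m y < m x" unfolding m_def
      using le lt k assms by (intro sum_strict_mono_ex1) (auto simp: nat_le_eq_zle intro: bexI[of _ k])
    with x(2)[OF \<open>P y\<close>] show False by simp
  qed
  with x(1) show ?thesis unfolding P_def by blast
qed

section \<open>Row reduction modulo \<open>p\<close> by integer combinations of rows\<close>

definition int_span :: "('e \<Rightarrow> 'i \<Rightarrow> int) \<Rightarrow> 'e set \<Rightarrow> ('i \<Rightarrow> int) set" where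
  "int_span g E = {\<lambda>i. \<Sum>e\<in>E. c e * g e i | c. True}"

text \<open>The dual system is what remains of reduced row echelon form modulo \<open>p\<close>, with pivots \<open>B\<close>.\<close>
definition dual_system ::
  "int \<Rightarrow> ('e \<Rightarrow> 'i \<Rightarrow> int) \<Rightarrow> 'e set \<Rightarrow> 'i set \<Rightarrow> ('i \<Rightarrow> 'i \<Rightarrow> int) \<Rightarrow> bool" where
  "dual_system p g E B r \<longleftrightarrow>
     (\<forall>i\<in>B. r i \<in> int_span g E) \<and> (\<forall>i\<in>B. \<forall>j\<in>B. [r i j = of_bool (i = j)] (mod p))"

lemma int_span_0: "(\<lambda>i. 0) \<in> int_span g E"
  unfolding int_span_def by (auto intro!: exI[of _ "\<lambda>_. 0"])

lemma int_span_lincomb: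
  assumes "v \<in> int_span g E" "w \<in> int_span g E"
  shows "(\<lambda>i. a * v i + b * w i) \<in> int_span g E"
proof -
  from assms obtain c d where
    "v = (\<lambda>i. \<Sum>e\<in>E. c e * g e i)" "w = (\<lambda>i. \<Sum>e\<in>E. d e * g e i)"
    unfolding int_span_def by blast
  then have "(\<lambda>i. a * v i + b * w i) = (\<lambda>i. \<Sum>e\<in>E. (a * c e + b * d e) * g e i)"
    by (simp add: sum_distrib_left sum.distrib algebra_simps)
  then show ?thesis
    unfolding int_span_def mem_Collect_eq by (intro exI[of _ "\<lambda>e. a * c e + b * d e"]) simp
qed

lemma int_span_sum:
  assumes "\<And>k. k \<in> K \<Longrightarrow> r k \<in> int_span g E"
  shows "(\<lambda>i. \<Sum>k\<in>K. a k * r k i) \<in> int_span g E"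
  using assms
proof (induction K rule: infinite_finite_induct)
  case (insert k K)
  then show ?case using int_span_lincomb[of "r k" g E "\<lambda>i. \<Sum>k\<in>K. a k * r k i" "a k" 1] by simp
qed (simp_all add: int_span_0)

lemma int_span_mono:
  assumes "finite E'" "E \<subseteq> E'"
  shows "int_span g E \<subseteq> int_span g E'"
proof
  fix v assume "v \<in> int_span g E"
  then obtain c where "v = (\<lambda>i. \<Sum>e\<in>E. c e * g e i)" unfolding int_span_def by blast
  then have "v = (\<lambda>i. \<Sum>e\<in>E'. (if e \<in> E then c e else 0) * g e i)"
    using assms by (auto simp: fun_eq_iff if_distrib[of "\<lambda>x. x * _"] sum.If_cases
        Int_absorb1 cong: if_cong)
  then show "v \<in> int_span g E'"
    unfolding int_span_def mem_Collect_eq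
    by (intro exI[of _ "\<lambda>e. if e \<in> E then c e else 0"]) simp
qed

lemma int_span_base:
  assumes "finite E" "e \<in> E"
  shows "g e \<in> int_span g E"
proof -
  have "g e = (\<lambda>i. \<Sum>f\<in>E. of_bool (f = e) * g f i)"
    using assms by (auto simp: fun_eq_iff of_bool_def if_distrib[of "\<lambda>x. x * _"] sum.delta cong: if_cong)
  then show ?thesis
    unfolding int_span_def mem_Collect_eq by (intro exI[of _ "\<lambda>f. of_bool (f = e)"]) simp
qed

lemma cong_sum_of_bool:
  fixes c :: "'i \<Rightarrow> int"
  assumes "finite B" "j \<in> B" "\<And>i. i \<in> B \<Longrightarrow> [r i = of_bool (i = j)] (mod p)"
  shows "[(\<Sum>i\<in>B. c i * r i) = c j] (mod p)"
proof -
  have "[(\<Sum>i\<in>B. c i * r i) = (\<Sum>i\<in>B. c i * of_bool (i = j))] (mod p)"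
    using assms by (intro cong_sum cong_scalar_left)
  also have "(\<Sum>i\<in>B. c i * of_bool (i = j)) = c j"
    using assms by (simp add: of_bool_def if_distrib[of "\<lambda>x. _ * x"] sum.delta cong: if_cong)
  finally show ?thesis .
qed

text \<open>One Gauss-Jordan step: the last hypothesis says that the row \<open>g e0\<close>, once
  cleared at the pivots in \<open>B\<close>, is still nonzero modulo \<open>p\<close> at
  \<open>j0\<close>, so \<open>j0\<close> can become a pivot.\<close>

lemma dual_system_extend:
  fixes p :: int
  assumes "prime p" "finite E" "finite B" "dual_system p g E B r" "j0 \<notin> B"
    and "\<not> [g e0 j0 = (\<Sum>i\<in>B. g e0 i * r i j0)] (mod p)"
  shows "\<exists>r'. dual_system p g (insert e0 E) (insert j0 B) r'"
proof -
  let ?E = "insert e0 E"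
  define s where "s j = g e0 j - (\<Sum>i\<in>B. g e0 i * r i j)" for j
  have r: "r i \<in> int_span g ?E" if "i \<in> B" for i
    using that assms(2,4) int_span_mono[of ?E E g] unfolding dual_system_def by blast
  have rd: "[r i j = of_bool (i = j)] (mod p)" if "i \<in> B" "j \<in> B" for i j
    using that assms(4) unfolding dual_system_def by blast
  have "s = (\<lambda>j. 1 * g e0 j + (-1) * (\<Sum>i\<in>B. g e0 i * r i j))" by (simp add: s_def fun_eq_iff)
  also have "\<dots> \<in> int_span g ?E"
    using assms(2) r by (intro int_span_lincomb int_span_base int_span_sum) auto
  finally have s: "s \<in> int_span g ?E" .
  have s0: "[s j = 0] (mod p)" if "j \<in> B" for j
  proof -
    have "[(\<Sum>i\<in>B. g e0 i * r i j) = g e0 j] (mod p)"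
      using that assms(3) rd by (intro cong_sum_of_bool) auto
    then show ?thesis unfolding s_def
      by (simp add: cong_diff_iff_cong_0 cong_sym)
  qed
  have "\<not> p dvd s j0"
    using assms(6) by (simp add: s_def cong_iff_dvd_diff)
  then have "coprime (s j0) p" using assms(1)
    by (metis coprime_commute prime_imp_coprime)
  then obtain t where t: "[s j0 * t = 1] (mod p)" using cong_solve_coprime_int by blast
  \<comment> \<open>\<open>t\<close> inverts the residual \<open>s j0\<close> modulo
    \<open>p\<close>, so \<open>v\<close> is the new row scaled to 1 at its pivot; \<open>r'\<close>
    then clears column \<open>j0\<close> from the old rows.\<close>
  define v where "v j = t * s j" for j
  have v: "v \<in> int_span g ?E"
    using int_span_lincomb[OF s s, of t 0] by (simp add: v_def[abs_def])
  have v0: "[v j = 0] (mod p)" if "j \<in> B" for j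
    using cong_scalar_left[OF s0[OF that], of t] by (simp add: v_def)
  have v1: "[v j0 = 1] (mod p)" using t by (simp add: v_def mult.commute)
  define r' where "r' i = (if i = j0 then v else (\<lambda>j. r i j - r i j0 * v j))" for i
  have "r' i \<in> int_span g ?E" if "i \<in> insert j0 B" for i
    using that v r int_span_lincomb[of "r i" g ?E v 1 "- r i j0"] by (auto simp: r'_def)
  moreover have "[r' i j = of_bool (i = j)] (mod p)"
    if i: "i \<in> insert j0 B" and j: "j \<in> insert j0 B" for i j
  proof (cases "i = j0")
    case True
    then show ?thesis using v0 v1 j assms(5) by (cases "j = j0") (auto simp: r'_def)
  next
    case False
    then have iB: "i \<in> B" using i by simp
    show ?thesis
    proof (cases "j = j0")
      case True
      have "[r i j0 - r i j0 * v j0 = r i j0 - r i j0 * 1] (mod p)"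
        by (intro cong_diff cong_scalar_left v1 cong_refl)
      then show ?thesis using True False by (simp add: r'_def)
    next
      case jn: False
      have "[r i j - r i j0 * v j = of_bool (i = j) - r i j0 * 0] (mod p)"
        using jn j by (intro cong_diff cong_scalar_left v0 rd iB) auto
      then show ?thesis using False by (simp add: r'_def)
    qed
  qed
  ultimately show ?thesis unfolding dual_system_def by blast
qed

text \<open>A largest pivot set works: a failing congruence would provide a further pivot. Its size
  is the rank modulo \<open>p\<close>, and every row is determined modulo \<open>p\<close> by its
  values on \<open>I\<close>.\<close>

lemma exists_spanning_dual_system:
  fixes p :: int
  assumes "prime p" "finite G" "finite N"
  shows "\<exists>I r. I \<subseteq> N \<and> dual_system p g G I r \<and>
           (\<forall>v\<in>G. \<forall>e\<in>N. [g v e = (\<Sum>i\<in>I. g v i * r i e)] (mod p))"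
proof -
  define P where "P I \<longleftrightarrow> I \<subseteq> N \<and> (\<exists>r. dual_system p g G I r)" for I
  have "P {}" by (simp add: P_def dual_system_def)
  moreover have "\<forall>I. P I \<longrightarrow> card I < Suc (card N)"
    using assms by (auto simp: P_def less_Suc_eq_le intro: card_mono)
  ultimately obtain I where I: "P I" "\<And>J. P J \<Longrightarrow> card J \<le> card I"
    using ex_has_greatest_nat[of P "{}" card "Suc (card N)"] by blast
  then obtain r where IN: "I \<subseteq> N" and r: "dual_system p g G I r" unfolding P_def by blast
  have fI: "finite I" using IN assms finite_subset by blast
  have "[g v e = (\<Sum>i\<in>I. g v i * r i e)] (mod p)" if "v \<in> G" "e \<in> N" for v e
  proof (cases "e \<in> I")
    case True
    then show ?thesis using r fI
      by (intro cong_sym[OF cong_sum_of_bool]) (auto simp: dual_system_def)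
  next
    case False
    show ?thesis
    proof (rule ccontr)
      assume "\<not> ?thesis"
      from dual_system_extend[OF assms(1,2) fI r False this]
      have "P (insert e I)" using that IN by (auto simp: P_def insert_absorb)
      from I(2)[OF this] show False using False fI by simp
    qed
  qed
  with IN r show ?thesis by blast
qed

text \<open>Reduce the row \<open>g e\<close> by each of the two blocks. If it differs from the
  first reduction at \<open>i\<close> and from the second at some \<open>j\<close> other than
  \<open>i\<close>, then \<open>e\<close>, \<open>i\<close> and \<open>j\<close> enlarge the pair.
  In a largest pair it therefore agrees off the blocks with the first reduction, or with the second
  except at \<open>i\<close>.\<close>

lemma exists_maximal_dual_pair:
  fixes p :: int
  assumes "prime p" "finite N" "finite I"
  shows "\<exists>E B1 B2 r1 r2. E \<subseteq> N \<and> B1 \<subseteq> I \<and> B2 \<subseteq> I \<and> B1 \<inter> B2 = {} \<and>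
           card E \<le> card B1 \<and> card B2 = card B1 \<and>
           dual_system p g E B1 r1 \<and> dual_system p g E B2 r2 \<and>
           (\<forall>e\<in>N. \<exists>v\<in>int_span g E. \<exists>i0. \<forall>j\<in>I - (B1 \<union> B2) - {i0}. [g e j = v j] (mod p))"
proof -
  define P where "P = (\<lambda>(E, B1, B2). E \<subseteq> N \<and> B1 \<subseteq> I \<and> B2 \<subseteq> I \<and> B1 \<inter> B2 = {} \<and>
           card E \<le> card B1 \<and> card B2 = card B1 \<and>
           (\<exists>r. dual_system p g E B1 r) \<and> (\<exists>r. dual_system p g E B2 r))"
  define m :: "'a set \<times> 'b set \<times> 'b set \<Rightarrow> nat" where "m = (\<lambda>(E, B1, B2). card B1)"
  have "P ({}, {}, {})" by (simp add: P_def dual_system_def)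
  moreover have "\<forall>t. P t \<longrightarrow> m t < Suc (card I)"
    using assms by (auto simp: P_def m_def less_Suc_eq_le intro: card_mono)
  ultimately obtain t where t: "P t" "\<And>u. P u \<Longrightarrow> m u \<le> m t"
    using ex_has_greatest_nat[of P "({}, {}, {})" m "Suc (card I)"] by blast
  obtain E B1 B2 where teq: "t = (E, B1, B2)" by (cases t)
  from t(1) obtain r1 r2 where *: "E \<subseteq> N" "B1 \<subseteq> I" "B2 \<subseteq> I" "B1 \<inter> B2 = {}"
    "card E \<le> card B1" "card B2 = card B1" "dual_system p g E B1 r1" "dual_system p g E B2 r2"
    by (auto simp: P_def teq)
  have fin: "finite E" "finite B1" "finite B2" using * assms finite_subset by blast+
  have "\<exists>v\<in>int_span g E. \<exists>i0. \<forall>j\<in>I - (B1 \<union> B2) - {i0}. [g e j = v j] (mod p)"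
    if e: "e \<in> N" for e
  proof -
    define v1 where "v1 j = (\<Sum>i\<in>B1. g e i * r1 i j)" for j
    define v2 where "v2 j = (\<Sum>i\<in>B2. g e i * r2 i j)" for j
    have v1: "v1 \<in> int_span g E" unfolding v1_def
      using *(7) by (intro int_span_sum) (auto simp: dual_system_def)
    have v2: "v2 \<in> int_span g E" unfolding v2_def
      using *(8) by (intro int_span_sum) (auto simp: dual_system_def)
    show ?thesis
    proof (cases "\<forall>j\<in>I - (B1 \<union> B2). [g e j = v1 j] (mod p)")
      case True
      then show ?thesis using v1 by blast
    next
      case False
      then obtain i where i: "i \<in> I" "i \<notin> B1" "i \<notin> B2" "\<not> [g e i = v1 i] (mod p)" by blast
      obtain r1' where r1': "dual_system p g (insert e E) (insert i B1) r1'"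
        using dual_system_extend[OF assms(1) fin(1,2) *(7) i(2)] i(4) unfolding v1_def by blast
      have "[g e j = v2 j] (mod p)" if j: "j \<in> I - (B1 \<union> B2) - {i}" for j
      proof (rule ccontr)
        assume "\<not> ?thesis"
        \<comment> \<open>The same new row \<open>e\<close> serves both blocks, and
          \<open>j \<noteq> i\<close> keeps them disjoint.\<close>
        then obtain r2' where r2': "dual_system p g (insert e E) (insert j B2) r2'"
          using dual_system_extend[OF assms(1) fin(1,3) *(8)] j unfolding v2_def by blast
        have "card (insert e E) \<le> Suc (card E)" using fin by (simp add: card_insert_if)
        then have "P (insert e E, insert i B1, insert j B2)"
          using * fin i j e r1' r2' by (auto simp: P_def)
        from t(2)[OF this] show False using fin i by (simp add: m_def teq)
      qed
      then show ?thesis using v2 by blast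
    qed
  qed
  with * show ?thesis
    by (intro exI[of _ E] exI[of _ B1] exI[of _ B2] exI[of _ r1] exI[of _ r2] conjI ballI)
qed

section \<open>Oddtowns modulo prime powers\<close>

text \<open>Set sizes are only known to be nonzero modulo \<open>p ^ a\<close>, hence may be
  divisible by \<open>p\<close>. What survives is divisibility of the coefficient by
  \<open>p\<close>, which is enough to contradict a primitive relation.\<close>

lemma prime_power_mult_dvd:
  fixes p :: int
  assumes "prime p" "p ^ a dvd x * m" "\<not> p ^ a dvd m"
  shows "p dvd x"
proof (rule ccontr)
  assume "\<not> p dvd x"
  then have "coprime (p ^ a) x" using assms(1) by (simp add: prime_imp_coprime)
  with assms(2,3) show False by (simp add: coprime_dvd_mult_right_iff)
qed

lemma dvd_sum_mult:
  fixes q :: "'a :: comm_semiring_1"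
  assumes "\<And>k. k \<in> K \<Longrightarrow> q dvd f k"
  shows "q dvd (\<Sum>k\<in>K. c k * f k)"
  using assms by (intro dvd_sum dvd_mult)

lemma dvd_of_add_eq_0:
  fixes q :: int
  assumes "a + b = 0" "q dvd a"
  shows "q dvd b"
  using assms by (simp add: add_eq_0_iff)

definition ind :: "'i set \<Rightarrow> 'i \<Rightarrow> int" where
  "ind A i = of_bool (i \<in> A)"

lemma sum_ind_mult:
  assumes "finite N" "A \<subseteq> N"
  shows "(\<Sum>e\<in>N. ind A e * ind B e) = int (card (A \<inter> B))"
proof -
  have "(\<Sum>e\<in>N. ind A e * ind B e) = (\<Sum>e\<in>N. of_bool (e \<in> A \<inter> B))"
    by (intro sum.cong) (auto simp: ind_def)
  also have "\<dots> = int (card (N \<inter> (A \<inter> B)))"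
    using assms by (simp add: Int_def)
  also have "N \<inter> (A \<inter> B) = A \<inter> B" using assms by blast
  finally show ?thesis .
qed

definition ppow_oddtown :: "int \<Rightarrow> 'i set set \<Rightarrow> bool" where
  "ppow_oddtown q F \<longleftrightarrow> (\<forall>A\<in>F. \<not> q dvd int (card A)) \<and>
     (\<forall>A\<in>F. \<forall>B\<in>F. A \<noteq> B \<longrightarrow> q dvd int (card (A \<inter> B)))"

text \<open>Pairing the relation with \<open>B\<close> kills every term modulo \<open>p ^ a\<close>
  except \<open>x B * int (card B)\<close>.\<close>

lemma ppow_oddtown_relation:
  fixes p :: int
  assumes "prime p" "finite N" "finite F" "\<And>A. A \<in> F \<Longrightarrow> A \<subseteq> N" "ppow_oddtown (p ^ a) F"
    and rel: "\<And>e. e \<in> N \<Longrightarrow> (\<Sum>A\<in>F. x A * ind A e) = 0" and "B \<in> F"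
  shows "p dvd x B"
proof -
  have "0 = (\<Sum>e\<in>N. (\<Sum>A\<in>F. x A * ind A e) * ind B e)" using rel by simp
  also have "\<dots> = (\<Sum>A\<in>F. x A * (\<Sum>e\<in>N. ind A e * ind B e))"
    unfolding sum_distrib_right sum_distrib_left by (subst sum.swap) (simp add: mult.assoc)
  also have "\<dots> = (\<Sum>A\<in>F. x A * int (card (A \<inter> B)))"
    using assms by (intro sum.cong) (simp_all add: sum_ind_mult)
  also have "\<dots> = x B * int (card B) + (\<Sum>A\<in>F-{B}. x A * int (card (A \<inter> B)))"
    using assms by (simp add: sum.remove)
  finally have "x B * int (card B) = - (\<Sum>A\<in>F-{B}. x A * int (card (A \<inter> B)))" by simp
  moreover have "p ^ a dvd (\<Sum>A\<in>F-{B}. x A * int (card (A \<inter> B)))"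
    using assms by (intro dvd_sum_mult) (auto simp: ppow_oddtown_def)
  ultimately have "p ^ a dvd x B * int (card B)" by simp
  then show ?thesis
    using prime_power_mult_dvd[OF assms(1)] assms(5,7) unfolding ppow_oddtown_def by blast
qed

text \<open>The case \<open>i \<notin> I\<close> is how a coordinate that is constant on the family is covered.\<close>
definition determined :: "'i set \<Rightarrow> 'i set \<Rightarrow> 'i set set \<Rightarrow> bool" where
  "determined N I H \<longleftrightarrow>
     (\<forall>e\<in>N. \<exists>i. \<forall>A\<in>H. \<forall>B\<in>H. (i \<in> I \<longrightarrow> (i \<in> A \<longleftrightarrow> i \<in> B)) \<longrightarrow> (e \<in> A \<longleftrightarrow> e \<in> B))"

text \<open>A 0-1 coordinate that depends on one other 0-1 coordinate is an affine function of it. A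
  relation that kills the constant function and the coordinates in \<open>I\<close> thus kills all
  coordinates, so more than \<open>card I + 1\<close> sets would contradict independence.\<close>

lemma card_affine_ppow_oddtown:
  fixes p :: int
  assumes "prime p" "finite N" "finite I" "finite F" "\<And>A. A \<in> F \<Longrightarrow> A \<subseteq> N"
    and "ppow_oddtown (p ^ a) F"
    and det: "determined N I F"
  shows "card F \<le> card I + 1"
proof (rule ccontr)
  assume "\<not> ?thesis"
  \<comment> \<open>\<open>None\<close> stands for the constant function and accounts for the
    summand 1.\<close>
  then have "card (insert None (Some ` I)) < card F"
    using assms(3) by (simp add: card_image)
  moreover have "finite (insert None (Some ` I))" using assms(3) by simp
  ultimately obtain x where x: "\<And>k. k \<in> insert None (Some ` I) \<Longrightarrow>
        (\<Sum>A\<in>F. x A * (case k of None \<Rightarrow> 1 | Some i \<Rightarrow> ind A i)) = 0"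
    and nd: "\<exists>A\<in>F. \<not> p dvd x A"
    using exists_primitive_int_relation[OF assms(1) _ assms(4),
      of "insert None (Some ` I)" "\<lambda>A k. case k of None \<Rightarrow> 1 | Some i \<Rightarrow> ind A i"] by blast
  have x0: "(\<Sum>A\<in>F. x A) = 0" using x[of None] by simp
  have xi: "(\<Sum>A\<in>F. x A * ind A i) = 0" if "i \<in> I" for i using x[of "Some i"] that by simp
  have "(\<Sum>A\<in>F. x A * ind A e) = 0" if e: "e \<in> N" for e
  proof -
    from det e obtain i where
      i: "\<And>A B. A \<in> F \<Longrightarrow> B \<in> F \<Longrightarrow> (i \<in> I \<longrightarrow> (i \<in> A \<longleftrightarrow> i \<in> B)) \<Longrightarrow> (e \<in> A \<longleftrightarrow> e \<in> B)" 
      unfolding determined_def by metis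
    have "\<exists>u v :: int. \<forall>A\<in>F. ind A e = u + v * (if i \<in> I then ind A i else 0)"
    proof (cases "i \<in> I")
      case False
      show ?thesis
      proof (cases "F = {}")
        case False
        then obtain A0 where "A0 \<in> F" by blast
        have "e \<in> A \<longleftrightarrow> e \<in> A0" if "A \<in> F" for A
          using i[OF that \<open>A0 \<in> F\<close>] \<open>i \<notin> I\<close> by blast
        then show ?thesis
          by (intro exI[of _ "ind A0 e"] exI[of _ 0]) (simp add: ind_def)
      qed simp
    next
      case True
      \<comment> \<open>\<open>u\<close> and \<open>w\<close> are the values at \<open>e\<close> for
        members without and with \<open>i\<close>, with default 0 when there are no such
        members.\<close>
      define u where "u = (of_bool (\<exists>A\<in>F. i \<notin> A \<and> e \<in> A) :: int)"
      define w where "w = (of_bool (\<exists>A\<in>F. i \<in> A \<and> e \<in> A) :: int)"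
      have "ind A e = u + (w - u) * ind A i" if "A \<in> F" for A
      proof (cases "i \<in> A")
        case True
        have "(\<exists>A\<in>F. i \<in> A \<and> e \<in> A) \<longleftrightarrow> e \<in> A" using True that i[OF that] by blast
        then show ?thesis using True by (simp add: ind_def w_def)
      next
        case False
        have "(\<exists>A\<in>F. i \<notin> A \<and> e \<in> A) \<longleftrightarrow> e \<in> A" using False that i[OF that] by blast
        then show ?thesis using False by (simp add: ind_def u_def)
      qed
      then show ?thesis using True by (intro exI[of _ u] exI[of _ "w - u"]) simp
    qed
    then obtain u v where uv: "\<And>A. A \<in> F \<Longrightarrow> ind A e = u + v * (if i \<in> I then ind A i else 0)"
      by blast
    have "(\<Sum>A\<in>F. x A * ind A e) = (\<Sum>A\<in>F. u * x A + v * (if i \<in> I then x A * ind A i else 0))"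
      by (intro sum.cong) (auto simp: uv algebra_simps)
    also have "\<dots> = u * (\<Sum>A\<in>F. x A) + v * (\<Sum>A\<in>F. if i \<in> I then x A * ind A i else 0)"
      by (simp add: sum.distrib sum_distrib_left)
    also have "\<dots> = 0" using x0 xi by (cases "i \<in> I") simp_all
    finally show ?thesis .
  qed
  from ppow_oddtown_relation[OF assms(1,2,4,5,6) this] nd show False by blast
qed

text \<open>
  The vectors \<open>r i\<close>, the members of \<open>F\<close> and the unit vectors at \<open>I\<close> are independent: pairing a
  relation with \<open>r i\<close>, then with the members of \<open>F\<close>, then reading off the coordinates in \<open>I\<close>, makes
  every coefficient divisible by \<open>p\<close>.
\<close>
lemma card_ppow_oddtown_rank:
  fixes p :: int
  assumes "prime p" "finite N" "finite F" "finite G" "a > 0"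
    and sub: "\<And>A. A \<in> F \<union> G \<Longrightarrow> A \<subseteq> N"
    and odd: "ppow_oddtown (p ^ a) F"
    and GG: "\<And>A B. A \<in> G \<Longrightarrow> B \<in> F \<union> G \<Longrightarrow> p ^ a dvd int (card (A \<inter> B))"
    and "I \<subseteq> N" "dual_system p ind G I r"
  shows "card F + 2 * card I \<le> card N"
proof (rule ccontr)
  assume neg: "\<not> ?thesis"
  let ?q = "p ^ a"
  have fI: "finite I" using assms finite_subset by blast
  define J where "J = I <+> (F <+> I)"
  define M where "M = case_sum r (case_sum ind (\<lambda>i. ind {i}))"
  have "card J = card F + 2 * card I" "finite J"
    using fI assms by (simp_all add: J_def card_Plus)
  then obtain x where rel: "\<And>e. e \<in> N \<Longrightarrow> (\<Sum>j\<in>J. x j * M j e) = 0"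
    and nd: "\<exists>j\<in>J. \<not> p dvd x j"
    using exists_primitive_int_relation[OF assms(1,2), of J M] neg by auto
  define \<alpha> where "\<alpha> i = x (Inl i)" for i
  define \<beta> where "\<beta> A = x (Inr (Inl A))" for A
  define \<gamma> where "\<gamma> i = x (Inr (Inr i))" for i
  have relv: "(\<Sum>i\<in>I. \<alpha> i * (\<Sum>e\<in>N. r i e * v e)) + (\<Sum>A\<in>F. \<beta> A * (\<Sum>e\<in>N. ind A e * v e))
      + (\<Sum>i\<in>I. \<gamma> i * v i) = 0" for v
  proof -
    have "0 = (\<Sum>e\<in>N. (\<Sum>j\<in>J. x j * M j e) * v e)" using rel by simp
    also have "\<dots> = (\<Sum>j\<in>J. x j * (\<Sum>e\<in>N. M j e * v e))"
      unfolding sum_distrib_right sum_distrib_left by (subst sum.swap) (simp add: mult.assoc)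
    also have "\<dots> = (\<Sum>i\<in>I. \<alpha> i * (\<Sum>e\<in>N. r i e * v e)) + ((\<Sum>A\<in>F. \<beta> A * (\<Sum>e\<in>N. ind A e * v e))
      + (\<Sum>i\<in>I. \<gamma> i * (\<Sum>e\<in>N. ind {i} e * v e)))"
      unfolding J_def using fI assms(3) by (simp add: sum.Plus M_def \<alpha>_def \<beta>_def \<gamma>_def)
    also have "(\<Sum>i\<in>I. \<gamma> i * (\<Sum>e\<in>N. ind {i} e * v e)) = (\<Sum>i\<in>I. \<gamma> i * v i)"
    proof (intro sum.cong refl)
      fix i assume "i \<in> I"
      then have "(\<Sum>e\<in>N. ind {i} e * v e) = (\<Sum>e\<in>N. if e = i then v e else 0)"
        by (intro sum.cong) (auto simp: ind_def)
      then show "\<gamma> i * (\<Sum>e\<in>N. ind {i} e * v e) = \<gamma> i * v i"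
        using \<open>i \<in> I\<close> assms(2,9) by auto
    qed
    finally show ?thesis by simp
  qed
  have rs: "r i \<in> int_span ind G" if "i \<in> I" for i using that assms(10) by (simp add: dual_system_def)
  have rd: "[r i j = of_bool (i = j)] (mod p)" if "i \<in> I" "j \<in> I" for i j
    using that assms(10) by (simp add: dual_system_def)
  \<comment> \<open>Because \<open>int_span\<close> has integer coefficients, orthogonality modulo
    the full power \<open>p ^ a\<close> passes from \<open>G\<close> to the vectors
    \<open>r i\<close>, although these are dual only modulo \<open>p\<close>.\<close>
  have orth: "?q dvd (\<Sum>e\<in>N. v e * w e)"
    if v: "v \<in> int_span ind G" and w: "\<And>A. A \<in> G \<Longrightarrow> ?q dvd (\<Sum>e\<in>N. ind A e * w e)" for v w
  proof -
    obtain c where c: "v = (\<lambda>i. \<Sum>A\<in>G. c A * ind A i)" using v unfolding int_span_def by blast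
    have "(\<Sum>e\<in>N. v e * w e) = (\<Sum>A\<in>G. c A * (\<Sum>e\<in>N. ind A e * w e))"
      unfolding c sum_distrib_right sum_distrib_left by (subst sum.swap) (simp add: mult.assoc)
    also have "?q dvd \<dots>" by (rule dvd_sum_mult) (rule w)
    finally show ?thesis .
  qed
  have Gset: "?q dvd (\<Sum>e\<in>N. ind A e * ind B e)" if "A \<in> G" "B \<in> F \<union> G" for A B
    using that GG sub assms(2) by (subst sum_ind_mult) auto
  have rset: "?q dvd (\<Sum>e\<in>N. r i e * ind B e)" if "i \<in> I" "B \<in> F \<union> G" for i B
    using orth[OF rs[OF that(1)]] Gset that by blast
  have rset': "?q dvd (\<Sum>e\<in>N. ind B e * r i e)" if "i \<in> I" "B \<in> F \<union> G" for i B
    using rset[OF that] by (simp only: mult.commute)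
  have rr: "?q dvd (\<Sum>e\<in>N. r i e * r j e)" if "i \<in> I" "j \<in> I" for i j
    using orth[OF rs[OF that(1)] rset'[OF that(2)]] by blast
  have fr: "?q dvd (\<Sum>e\<in>N. ind A e * r i e)" if "i \<in> I" "A \<in> F" for i A
    using rset' that by blast
  have gr: "?q dvd (\<Sum>k\<in>I. \<gamma> k * r i k)" if "i \<in> I" for i
  proof -
    have "?q dvd (\<Sum>k\<in>I. \<alpha> k * (\<Sum>e\<in>N. r k e * r i e)) + (\<Sum>A\<in>F. \<beta> A * (\<Sum>e\<in>N. ind A e * r i e))"
      by (rule dvd_add; rule dvd_sum_mult) (use rr fr that in auto)
    with relv[of "r i"] show ?thesis by (rule dvd_of_add_eq_0)
  qed
  \<comment> \<open>Duality modulo \<open>p\<close> is lifted one factor at a time: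
    \<open>r i k - of_bool (i = k)\<close> contributes one \<open>p\<close> and the induction
    hypothesis \<open>p ^ b\<close>. The full power \<open>p ^ a\<close> is needed when pairing with
    members of \<open>F\<close>.\<close>
  have gam: "p ^ b dvd \<gamma> i" if "b \<le> a" "i \<in> I" for b i
    using that
  proof (induction b arbitrary: i)
    case (Suc b)
    have "p ^ Suc b dvd (r i k - of_bool (i = k)) * \<gamma> k" if k: "k \<in> I" for k
    proof -
      have "p dvd r i k - of_bool (i = k)"
        using rd[OF Suc.prems(2) k] by (simp only: cong_iff_dvd_diff)
      moreover have "p ^ b dvd \<gamma> k" using Suc.IH[of k] Suc.prems(1) k by simp
      ultimately show ?thesis unfolding power_Suc by (rule mult_dvd_mono)
    qed
    then have "p ^ Suc b dvd (\<Sum>k\<in>I. (r i k - of_bool (i = k)) * \<gamma> k)" by (intro dvd_sum)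
    also have "(\<Sum>k\<in>I. (r i k - of_bool (i = k)) * \<gamma> k) = (\<Sum>k\<in>I. \<gamma> k * r i k) - \<gamma> i"
    proof -
      have "(\<Sum>k\<in>I. of_bool (i = k) * \<gamma> k) = (\<Sum>k\<in>I. if i = k then \<gamma> k else 0)"
        by (intro sum.cong) auto
      also have "\<dots> = \<gamma> i" using fI Suc.prems by (simp add: sum.delta)
      finally show ?thesis by (simp only: left_diff_distrib sum_subtractf mult.commute[of "\<gamma> _"])
    qed
    finally have 1: "p ^ Suc b dvd (\<Sum>k\<in>I. \<gamma> k * r i k) - \<gamma> i" .
    have "p ^ Suc b dvd (\<Sum>k\<in>I. \<gamma> k * r i k)"
      using dvd_trans[OF le_imp_power_dvd[OF Suc.prems(1)] gr[OF Suc.prems(2)]] .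
    from dvd_diff[OF this 1] show ?case by simp
  qed simp
  have bet: "p dvd \<beta> B" if B: "B \<in> F" for B
  proof -
    have 1: "?q dvd (\<Sum>i\<in>I. \<alpha> i * (\<Sum>e\<in>N. r i e * ind B e)) + (\<Sum>i\<in>I. \<gamma> i * ind B i)"
      by (rule dvd_add, rule dvd_sum_mult, use rset B in blast, rule dvd_sum[OF dvd_mult2], use gam[of a] in simp)
    have "(\<Sum>i\<in>I. \<alpha> i * (\<Sum>e\<in>N. r i e * ind B e)) + (\<Sum>i\<in>I. \<gamma> i * ind B i)
        + (\<Sum>A\<in>F. \<beta> A * (\<Sum>e\<in>N. ind A e * ind B e)) = 0"
      using relv[of "ind B"] by simp
    from dvd_of_add_eq_0[OF this 1]
    have "?q dvd (\<Sum>A\<in>F. \<beta> A * (\<Sum>e\<in>N. ind A e * ind B e))" .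
    also have "(\<Sum>A\<in>F. \<beta> A * (\<Sum>e\<in>N. ind A e * ind B e)) =
        \<beta> B * int (card B) + (\<Sum>A\<in>F-{B}. \<beta> A * int (card (A \<inter> B)))"
      using assms(2,3) B sub by (simp add: sum_ind_mult sum.remove)
    finally have "?q dvd \<beta> B * int (card B) + (\<Sum>A\<in>F-{B}. \<beta> A * int (card (A \<inter> B)))" .
    moreover have "?q dvd (\<Sum>A\<in>F-{B}. \<beta> A * int (card (A \<inter> B)))"
      using odd B by (intro dvd_sum_mult) (auto simp: ppow_oddtown_def)
    ultimately have "?q dvd \<beta> B * int (card B)" by (simp only: dvd_add_left_iff)
    then show ?thesis
      using prime_power_mult_dvd[OF assms(1)] odd B unfolding ppow_oddtown_def by blast
  qed
  have "p dvd \<alpha> k" if k: "k \<in> I" for k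
  proof -
    have kN: "k \<in> N" using k assms(9) by blast
    have "(\<Sum>i\<in>I. \<alpha> i * r i k) + ((\<Sum>A\<in>F. \<beta> A * ind A k) + (\<Sum>i\<in>I. \<gamma> i * ind {i} k)) = 0"
      using rel[OF kN] unfolding J_def using fI assms(3)
      by (simp add: sum.Plus M_def \<alpha>_def \<beta>_def \<gamma>_def)
    then have "((\<Sum>A\<in>F. \<beta> A * ind A k) + (\<Sum>i\<in>I. \<gamma> i * ind {i} k)) + (\<Sum>i\<in>I. \<alpha> i * r i k) = 0"
      by simp
    moreover have "p dvd (\<Sum>A\<in>F. \<beta> A * ind A k) + (\<Sum>i\<in>I. \<gamma> i * ind {i} k)"
      by (rule dvd_add; rule dvd_sum[OF dvd_mult2]) (use bet gam[of 1] \<open>a > 0\<close> in auto)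
    ultimately have "p dvd (\<Sum>i\<in>I. \<alpha> i * r i k)" by (rule dvd_of_add_eq_0)
    moreover have "[(\<Sum>i\<in>I. \<alpha> i * r i k) = \<alpha> k] (mod p)"
      using fI k rd by (intro cong_sum_of_bool) auto
    ultimately show ?thesis using cong_dvd_iff by blast
  qed
  then have "p dvd x j" if "j \<in> J" for j
    using that bet gam[of 1] \<open>a > 0\<close> unfolding J_def \<alpha>_def \<beta>_def \<gamma>_def by auto
  with nd show False by blast
qed

section \<open>Counting 0-1 vectors modulo an odd prime\<close>

lemma card_eq_sum_fibres:
  assumes "finite X" "finite R" "f ` X \<subseteq> R"
  shows "card X = (\<Sum>r\<in>R. card {x\<in>X. f x = r})"
  using sum_fun_comp[OF assms, of "\<lambda>_. 1::nat"] by simp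

lemma card_fibre_product:
  assumes "finite X" "finite Y" "finite R" "f ` X \<subseteq> R"
  shows "card {(a, b) \<in> X \<times> Y. f a = h b} =
           (\<Sum>r\<in>R. card {a\<in>X. f a = r} * card {b\<in>Y. h b = r})"
proof -
  have "{(a, b) \<in> X \<times> Y. f a = h b} = (\<Union>r\<in>R. {a\<in>X. f a = r} \<times> {b\<in>Y. h b = r})"
    using assms(4) by auto
  then show ?thesis
    using assms by (simp add: card_UN_disjoint card_cartesian_product disjoint_iff)
qed

text \<open>AM-GM applied to the two fibre sizes over each common value.\<close>

lemma card_fibre_product_le:
  assumes "finite X" "finite Y"
  shows "2 * card {(a, b) \<in> X \<times> Y. f a = h b} \<le>
           card {(a, b) \<in> X \<times> X. f a = f b} + card {(a, b) \<in> Y \<times> Y. h a = h b}"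
proof -
  let ?R = "f ` X \<union> h ` Y"
  define \<alpha> where "\<alpha> r = card {a\<in>X. f a = r}" for r
  define \<beta> where "\<beta> r = card {b\<in>Y. h b = r}" for r
  have am_gm: "2 * (m * n) \<le> m * m + n * n" for m n :: nat
  proof -
    have "0 \<le> (int m - int n) * (int m - int n)" by simp
    then have "int (2 * (m * n)) \<le> int (m * m + n * n)" by (simp add: algebra_simps)
    then show ?thesis by (simp only: of_nat_le_iff)
  qed
  have "2 * card {(a, b) \<in> X \<times> Y. f a = h b} = (\<Sum>r\<in>?R. 2 * (\<alpha> r * \<beta> r))"
    using assms unfolding \<alpha>_def \<beta>_def sum_distrib_left[symmetric]
    by (subst card_fibre_product[of X Y ?R]) auto
  also have "\<dots> \<le> (\<Sum>r\<in>?R. \<alpha> r * \<alpha> r + \<beta> r * \<beta> r)" by (intro sum_mono am_gm)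
  also have "\<dots> = card {(a, b) \<in> X \<times> X. f a = f b} + card {(a, b) \<in> Y \<times> Y. h a = h b}"
    using assms unfolding \<alpha>_def \<beta>_def sum.distrib
    by (subst (1 2) card_fibre_product[of _ _ ?R]) auto
  finally show ?thesis .
qed

text \<open>Cauchy-Schwarz for the fibre sizes.\<close>

lemma card_squared_le_collisions:
  assumes "finite X" "finite R" "f ` X \<subseteq> R"
  shows "(card X)\<^sup>2 \<le> card R * card {(a, b) \<in> X \<times> X. f a = f b}"
proof -
  define \<alpha> where "\<alpha> r = card {a\<in>X. f a = r}" for r
  have "real ((card X)\<^sup>2) = (\<Sum>r\<in>R. real (\<alpha> r))\<^sup>2"
    using card_eq_sum_fibres[OF assms] by (simp add: \<alpha>_def)
  also have "\<dots> \<le> (\<Sum>r\<in>R. (real (\<alpha> r))\<^sup>2) * real (card R)"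
    by (rule sum_squared_le_sum_of_squares)
  also have "(\<Sum>r\<in>R. (real (\<alpha> r))\<^sup>2) = real (card {(a, b) \<in> X \<times> X. f a = f b})"
    using assms by (subst card_fibre_product[of _ _ R]) (auto simp: \<alpha>_def power2_eq_square)
  finally have "real ((card X)\<^sup>2) \<le> real (card R * card {(a, b) \<in> X \<times> X. f a = f b})"
    by (simp add: mult.commute)
  then show ?thesis by (simp only: of_nat_le_iff)
qed

text \<open>The condition splits over the points of \<open>B\<close>. Of the 16 bit patterns at a
  point, difference 0 allows 4 and the differences 1 and -1 allow one each, in total 6.\<close>

lemma card_ind_difference_collisions:
  assumes "finite B"
  shows "card {((x, x'), (y, y')) \<in> (Pow B \<times> Pow B) \<times> (Pow B \<times> Pow B).
            \<forall>i\<in>B. ind x i - ind x' i = ind y i - ind y' i} \<le> 6 ^ card B" (is "card ?Q \<le> _")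
proof -
  define V where "V = {(True, True, True, True), (True, True, False, False),
    (False, False, True, True), (False, False, False, False),
    (True, False, True, False), (False, True, False, True)}"
  have "card V = 6" by (simp add: V_def)
  define \<phi> where "\<phi> = (\<lambda>((x, x'), (y, y')). \<lambda>i\<in>B. (i \<in> x, i \<in> x', i \<in> y, i \<in> y'))"
  have "\<phi> ` ?Q \<subseteq> PiE B (\<lambda>_. V)"
  proof (rule image_subsetI)
    fix s assume s: "s \<in> ?Q"
    obtain x x' y y' where s': "s = ((x, x'), (y, y'))" by (metis surj_pair)
    have "(i \<in> x, i \<in> x', i \<in> y, i \<in> y') \<in> V" if "i \<in> B" for i
    proof -
      have "ind x i - ind x' i = ind y i - ind y' i" using s that unfolding s' by blast
      then show ?thesis
        by (cases "i \<in> x"; cases "i \<in> x'"; cases "i \<in> y"; cases "i \<in> y'")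
          (simp_all add: ind_def V_def)
    qed
    then show "\<phi> s \<in> PiE B (\<lambda>_. V)" by (simp add: \<phi>_def s')
  qed
  moreover have inj: "inj_on \<phi> ?Q"
  proof (rule inj_onI)
    fix s t assume s: "s \<in> ?Q" and t: "t \<in> ?Q" and eq: "\<phi> s = \<phi> t"
    obtain x x' y y' where s': "s = ((x, x'), (y, y'))" by (metis surj_pair)
    obtain u u' v v' where t': "t = ((u, u'), (v, v'))" by (metis surj_pair)
    have "(i \<in> x, i \<in> x', i \<in> y, i \<in> y') = (i \<in> u, i \<in> u', i \<in> v, i \<in> v')" if "i \<in> B" for i
      using fun_cong[OF eq, of i] that by (simp add: \<phi>_def s' t')
    with s t show "s = t" unfolding s' t' by blast
  qed
  moreover have "finite (PiE B (\<lambda>_. V))" using assms by (intro finite_PiE) (auto simp: V_def)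
  ultimately have "card ?Q \<le> card (PiE B (\<lambda>_. V))" using inj card_inj_on_le by blast
  also have "\<dots> = 6 ^ card B" using assms \<open>card V = 6\<close> by (simp add: card_PiE)
  finally show ?thesis .
qed

text \<open>The combination of rows that produces \<open>r i\<close>, applied to the hypotheses,
  isolates coordinate \<open>i\<close>: a dual system is a left inverse of the block modulo
  \<open>p\<close>.\<close>

lemma dual_system_cancel:
  fixes p :: int
  assumes "dual_system p g E B r" "finite B"
    and "\<And>e. e \<in> E \<Longrightarrow> [(\<Sum>i\<in>B. g e i * u i) = (\<Sum>i\<in>B. g e i * v i)] (mod p)"
    and "i \<in> B"
  shows "[u i = v i] (mod p)"
proof -
  obtain c where c: "r i = (\<lambda>j. \<Sum>e\<in>E. c e * g e j)"
    using assms(1,4) unfolding dual_system_def int_span_def by blast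
  have expand: "(\<Sum>j\<in>B. u j * r i j) = (\<Sum>e\<in>E. c e * (\<Sum>j\<in>B. g e j * u j))" for u
    unfolding c sum_distrib_left by (subst sum.swap) (simp add: mult_ac)
  have coord: "[(\<Sum>j\<in>B. u j * r i j) = u i] (mod p)" for u
  proof (rule cong_sum_of_bool[OF assms(2,4)])
    fix j assume "j \<in> B"
    then have "[r i j = of_bool (i = j)] (mod p)"
      using assms(1,4) by (simp add: dual_system_def)
    then show "[r i j = of_bool (j = i)] (mod p)" by (simp only: eq_commute[of j i])
  qed
  have "[u i = (\<Sum>j\<in>B. u j * r i j)] (mod p)" using coord by (rule cong_sym)
  also have "[(\<Sum>j\<in>B. u j * r i j) = (\<Sum>j\<in>B. v j * r i j)] (mod p)"
    unfolding expand by (rule cong_sum, rule cong_scalar_left, rule assms(3))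
  also have "[(\<Sum>j\<in>B. v j * r i j) = v i] (mod p)" by (rule coord)
  finally show ?thesis .
qed

text \<open>
  This is where \<open>p\<close> odd matters: \<open>-1, 0, 1\<close> are distinct modulo \<open>p\<close>, so two pairs of subsets of a block with
  the same image have the same difference, which leaves \<open>6 ^ card B\<close> collisions. Cauchy-Schwarz over
  the traces on \<open>E\<close> and AM-GM between the two blocks then give \<open>12 ^ (k / 2)\<close> instead of \<open>4 ^ k\<close>.
\<close>
lemma card_dual_pair_section:
  fixes p :: int
  assumes "p > 2" "finite H" "finite E" "finite B1" "finite B2" "card B2 = card B1"
    and d1: "dual_system p g E B1 r1" and d2: "dual_system p g E B2 r2"
    and inj: "inj_on (\<lambda>A. (A \<inter> B1, A \<inter> B2)) H"
    and rep: "\<And>A e. A \<in> H \<Longrightarrow> e \<in> E \<Longrightarrow>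
      [ind A e = c e + (\<Sum>i\<in>B1. g e i * ind A i) + (\<Sum>i\<in>B2. g e i * ind A i)] (mod p)"
  shows "(card H)\<^sup>2 \<le> 2 ^ card E * 6 ^ card B1"
proof -
  define D where "D B = (\<lambda>(x, x'). \<lambda>e\<in>E. (\<Sum>i\<in>B. g e i * (ind x i - ind x' i)) mod p)" for B
  let ?Q1 = "Pow B1 \<times> Pow B1" and ?Q2 = "Pow B2 \<times> Pow B2"
  \<comment> \<open>Both sides will be differences of bits, so they are at most 2 apart, which is
    less than \<open>p\<close>.\<close>
  have small: "s = t" if "[s = t] (mod p)" "\<bar>s - t\<bar> \<le> 2" for s t :: int
  proof -
    have "p dvd \<bar>s - t\<bar>" using that(1) by (simp add: cong_iff_dvd_diff)
    then have "\<not> 0 < \<bar>s - t\<bar>"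
      using that(2) assms(1) zdvd_not_zless[of "\<bar>s - t\<bar>" p] by linarith
    then show ?thesis by linarith
  qed
  have bd: "\<bar>ind a i - ind b i - (ind c i - ind d i)\<bar> \<le> 2" for a b c d and i :: 'b
    by (simp add: ind_def of_bool_def)
  have coll: "card {(a, b) \<in> (Pow B \<times> Pow B) \<times> (Pow B \<times> Pow B). D B a = D B b} \<le> 6 ^ card B"
    if d: "dual_system p g E B r" and fB: "finite B" for B r
  proof -
    let ?Q = "Pow B \<times> Pow B"
    have "{(a, b) \<in> ?Q \<times> ?Q. D B a = D B b} \<subseteq> {((x, x'), (y, y')) \<in> ?Q \<times> ?Q.
            \<forall>i\<in>B. ind x i - ind x' i = ind y i - ind y' i}"
    proof (clarify, intro conjI ballI)
      fix x x' y y' i assume eq: "D B (x, x') = D B (y, y')" and i: "i \<in> B"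
      have eqE: "[(\<Sum>i\<in>B. g e i * (ind x i - ind x' i)) = (\<Sum>i\<in>B. g e i * (ind y i - ind y' i))] (mod p)"
        if "e \<in> E" for e
        using fun_cong[OF eq, of e] that unfolding D_def unique_euclidean_semiring_class.cong_def by simp
      show "ind x i - ind x' i = ind y i - ind y' i"
        by (rule small[OF dual_system_cancel[OF d fB eqE i] bd])
    qed auto
    moreover have "finite {((x, x'), (y, y')) \<in> ?Q \<times> ?Q.
            \<forall>i\<in>B. ind x i - ind x' i = ind y i - ind y' i}"
      by (rule finite_subset[of _ "?Q \<times> ?Q"]) (use fB in auto)
    ultimately show ?thesis
      by (rule le_trans[OF card_mono[rotated] card_ind_difference_collisions[OF fB]])
  qed
  have "2 * card {(a, b) \<in> ?Q1 \<times> ?Q2. D B1 a = D B2 b} \<le> 2 * 6 ^ card B1"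
    using card_fibre_product_le[of ?Q1 ?Q2 "D B1" "D B2"] coll[OF d1] coll[OF d2] assms(4,5,6) by simp
  then have c3: "card {(a, b) \<in> ?Q1 \<times> ?Q2. D B1 a = D B2 b} \<le> 6 ^ card B1" by simp
  \<comment> \<open>The order is swapped on \<open>B2\<close>: when \<open>A\<close> and
    \<open>A'\<close> agree on \<open>E\<close>, the changes contributed by the two blocks cancel
    modulo \<open>p\<close>, so the difference on \<open>B1\<close> matches the reversed difference
    on \<open>B2\<close>.\<close>
  define \<psi> where "\<psi> = (\<lambda>(A, A'). ((A \<inter> B1, A' \<inter> B1), (A' \<inter> B2, A \<inter> B2)))"
  have img: "\<psi> ` {(A, A') \<in> H \<times> H. A \<inter> E = A' \<inter> E} \<subseteq> {(a, b) \<in> ?Q1 \<times> ?Q2. D B1 a = D B2 b}"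
  proof (rule image_subsetI)
    fix u assume u: "u \<in> {(A, A') \<in> H \<times> H. A \<inter> E = A' \<inter> E}"
    obtain A A' where u': "u = (A, A')" by (cases u)
    have A: "A \<in> H" "A' \<in> H" "A \<inter> E = A' \<inter> E" using u unfolding u' by auto
    have "(\<Sum>i\<in>B1. g e i * (ind (A \<inter> B1) i - ind (A' \<inter> B1) i)) mod p =
          (\<Sum>i\<in>B2. g e i * (ind (A' \<inter> B2) i - ind (A \<inter> B2) i)) mod p" if e: "e \<in> E" for e
    proof -
      have ie: "ind A e = ind A' e" using A(3) e by (auto simp: ind_def)
      have "[c e + (\<Sum>i\<in>B1. g e i * ind A i) + (\<Sum>i\<in>B2. g e i * ind A i) =
            c e + (\<Sum>i\<in>B1. g e i * ind A' i) + (\<Sum>i\<in>B2. g e i * ind A' i)] (mod p)"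
        by (rule cong_trans[OF cong_sym[OF rep[OF A(1) e, unfolded ie]] rep[OF A(2) e]])
      then have "p dvd ((\<Sum>i\<in>B1. g e i * ind A i) - (\<Sum>i\<in>B1. g e i * ind A' i)) -
          ((\<Sum>i\<in>B2. g e i * ind A' i) - (\<Sum>i\<in>B2. g e i * ind A i))"
        by (simp add: cong_iff_dvd_diff algebra_simps)
      then have "[(\<Sum>i\<in>B1. g e i * (ind A i - ind A' i)) =
          (\<Sum>i\<in>B2. g e i * (ind A' i - ind A i))] (mod p)"
        by (simp add: cong_iff_dvd_diff right_diff_distrib sum_subtractf)
      moreover have "(\<Sum>i\<in>B1. g e i * (ind (A \<inter> B1) i - ind (A' \<inter> B1) i)) =
          (\<Sum>i\<in>B1. g e i * (ind A i - ind A' i))"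
        by (intro sum.cong) (auto simp: ind_def)
      moreover have "(\<Sum>i\<in>B2. g e i * (ind (A' \<inter> B2) i - ind (A \<inter> B2) i)) =
          (\<Sum>i\<in>B2. g e i * (ind A' i - ind A i))"
        by (intro sum.cong) (auto simp: ind_def)
      ultimately show ?thesis by (simp add: unique_euclidean_semiring_class.cong_def)
    qed
    then have "D B1 (A \<inter> B1, A' \<inter> B1) = D B2 (A' \<inter> B2, A \<inter> B2)"
      unfolding D_def by (auto intro!: restrict_ext)
    then show "\<psi> u \<in> {(a, b) \<in> ?Q1 \<times> ?Q2. D B1 a = D B2 b}"
      by (auto simp: \<psi>_def u')
  qed
  have inj\<psi>: "inj_on \<psi> {(A, A') \<in> H \<times> H. A \<inter> E = A' \<inter> E}"
  proof (rule inj_onI)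
    fix u v
    assume u: "u \<in> {(A, A') \<in> H \<times> H. A \<inter> E = A' \<inter> E}"
      and v: "v \<in> {(A, A') \<in> H \<times> H. A \<inter> E = A' \<inter> E}" and eq: "\<psi> u = \<psi> v"
    obtain A A' B B' where uv: "u = (A, A')" "v = (B, B')" by (cases u, cases v)
    have "A \<in> H" "A' \<in> H" "B \<in> H" "B' \<in> H" using u v unfolding uv by auto
    moreover have "(A \<inter> B1, A \<inter> B2) = (B \<inter> B1, B \<inter> B2)" "(A' \<inter> B1, A' \<inter> B2) = (B' \<inter> B1, B' \<inter> B2)"
      using eq unfolding uv \<psi>_def by simp_all
    ultimately have "A = B" "A' = B'" using inj_onD[OF inj] by blast+
    then show "u = v" unfolding uv by simp
  qed
  have "finite {(a, b) \<in> ?Q1 \<times> ?Q2. D B1 a = D B2 b}"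
    by (rule finite_subset[of _ "?Q1 \<times> ?Q2"]) (use assms in auto)
  then have "card {(A, A') \<in> H \<times> H. A \<inter> E = A' \<inter> E} \<le> 6 ^ card B1"
    by (rule le_trans[OF card_inj_on_le[OF inj\<psi> img] c3])
  then have "card (Pow E) * card {(A, A') \<in> H \<times> H. A \<inter> E = A' \<inter> E} \<le> 2 ^ card E * 6 ^ card B1"
    using assms(3) by (simp add: card_Pow)
  moreover have "(card H)\<^sup>2 \<le> card (Pow E) * card {(A, A') \<in> H \<times> H. A \<inter> E = A' \<inter> E}"
    using assms by (intro card_squared_le_collisions) auto
  ultimately show ?thesis by (rule le_trans[rotated])
qed

section \<open>From bounds on fibres to bounds on the whole family\<close>

lemma card_squared_le_fibres:
  assumes "finite X" "finite R" "f ` X \<subseteq> R" "\<And>r. r \<in> R \<Longrightarrow> (card {x\<in>X. f x = r})\<^sup>2 \<le> M"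
  shows "(card X)\<^sup>2 \<le> (card R)\<^sup>2 * M"
proof -
  define \<alpha> where "\<alpha> r = card {x\<in>X. f x = r}" for r
  have "real ((card X)\<^sup>2) = (\<Sum>r\<in>R. real (\<alpha> r))\<^sup>2"
    using card_eq_sum_fibres[OF assms(1-3)] by (simp add: \<alpha>_def)
  also have "\<dots> \<le> (\<Sum>r\<in>R. (real (\<alpha> r))\<^sup>2) * real (card R)"
    by (rule sum_squared_le_sum_of_squares)
  also have "(\<Sum>r\<in>R. (real (\<alpha> r))\<^sup>2) \<le> (\<Sum>r\<in>R. real M)"
  proof (rule sum_mono)
    fix r assume "r \<in> R"
    then have "(\<alpha> r)\<^sup>2 \<le> M" using assms(4) by (simp add: \<alpha>_def)
    then have "real ((\<alpha> r)\<^sup>2) \<le> real M" by (simp only: of_nat_le_iff)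
    then show "(real (\<alpha> r))\<^sup>2 \<le> real M" by simp
  qed
  finally have "real ((card X)\<^sup>2) \<le> real ((card R)\<^sup>2 * M)"
    by (simp add: power2_eq_square mult_ac mult_right_mono)
  then show ?thesis by (simp only: of_nat_le_iff)
qed

lemma card_le_fibres:
  assumes "finite X" "finite R" "f ` X \<subseteq> R" "\<And>r. r \<in> R \<Longrightarrow> card {x\<in>X. f x = r} \<le> M"
  shows "card X \<le> card R * M"
proof -
  have "card X = (\<Sum>r\<in>R. card {x\<in>X. f x = r})" by (rule card_eq_sum_fibres[OF assms(1-3)])
  also have "\<dots> \<le> card R * M" using sum_bounded_above[of R "\<lambda>r. card {x\<in>X. f x = r}" M] assms(4) by simp
  finally show ?thesis .
qed

lemma ind_cong_imp_eq:
  fixes p :: int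
  assumes "p > 1" "[ind A e = ind B e] (mod p)"
  shows "e \<in> A \<longleftrightarrow> e \<in> B"
  using assms by (auto simp: ind_def of_bool_def cong_iff_dvd_diff zdvd1_eq split: if_splits)

lemma spanned_inter_eq_imp_eq:
  fixes p :: int
  assumes "p > 1" "A \<subseteq> N" "B \<subseteq> N"
    and rA: "\<And>e. e \<in> N \<Longrightarrow> [ind A e = (\<Sum>i\<in>I. ind A i * w i e)] (mod p)"
    and rB: "\<And>e. e \<in> N \<Longrightarrow> [ind B e = (\<Sum>i\<in>I. ind B i * w i e)] (mod p)"
    and eq: "A \<inter> I = B \<inter> I"
  shows "A = B"
proof -
  have "e \<in> A \<longleftrightarrow> e \<in> B" if "e \<in> N" for e
  proof -
    have "(\<Sum>i\<in>I. ind A i * w i e) = (\<Sum>i\<in>I. ind B i * w i e)"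
      using eq by (intro sum.cong) (auto simp: ind_def)
    then have "[ind A e = ind B e] (mod p)"
      using rA[OF that] rB[OF that] by (simp add: unique_euclidean_semiring_class.cong_def)
    then show ?thesis by (rule ind_cong_imp_eq[OF assms(1)])
  qed
  then show ?thesis using assms(2,3) by blast
qed

text \<open>\<open>k\<close> is the block size of a maximal pair. A large \<open>k\<close> makes the
  first bound strong; a small \<open>k\<close> makes the second strong, since fixing the traces on
  both blocks and on \<open>E\<close> leaves at most \<open>2 ^ (2 * k) * 2 ^ k = 8 ^ k\<close>
  classes.\<close>

lemma maximal_dual_pair_bounds:
  fixes p :: int
  assumes "prime p" "p > 2" "finite N" "finite G" "\<And>A. A \<in> G \<Longrightarrow> A \<subseteq> N" "I \<subseteq> N"
    and rep: "\<And>A e. A \<in> G \<Longrightarrow> e \<in> N \<Longrightarrow> [ind A e = (\<Sum>i\<in>I. ind A i * w i e)] (mod p)"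
  shows "\<exists>k. 16 ^ k * (card G)\<^sup>2 \<le> 4 ^ card I * 12 ^ k \<and>
    (\<forall>M. (\<forall>H\<subseteq>G. determined N I H \<longrightarrow> card H \<le> M) \<longrightarrow> card G \<le> 8 ^ k * M)"
proof -
  have fI: "finite I" using assms finite_subset by blast
  define g where "g e i = w i e" for e i
  obtain E B1 B2 r1 r2 where pair: "E \<subseteq> N" "B1 \<subseteq> I" "B2 \<subseteq> I" "B1 \<inter> B2 = {}"
      "card E \<le> card B1" "card B2 = card B1"
      "dual_system p g E B1 r1" "dual_system p g E B2 r2"
    and maximal: "\<And>e. e \<in> N \<Longrightarrow>
      \<exists>v\<in>int_span g E. \<exists>i0. \<forall>j\<in>I - (B1 \<union> B2) - {i0}. [g e j = v j] (mod p)"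
    using exists_maximal_dual_pair[OF assms(1,3) fI, of g] by metis
  define k where "k = card B1"
  let ?T = "B1 \<union> B2"
  have fin: "finite E" "finite B1" "finite B2" "finite ?T"
    using pair assms(3) fI finite_subset by blast+
  have cT: "card ?T = 2 * k"
    using fin pair by (simp add: card_Un_disjoint k_def)
  have TI: "?T \<subseteq> I" using pair by blast
  have cI: "card I = card (I - ?T) + 2 * k"
    using card_Diff_subset[OF fin(4) TI] card_mono[OF fI TI] cT by simp
  have recon: "A = B" if "A \<in> G" "B \<in> G" "A \<inter> I = B \<inter> I" for A B
    by (rule spanned_inter_eq_imp_eq[where p = p and N = N and I = I and w = w]) (use that assms in auto)
  have "(card {A\<in>G. A \<inter> (I - ?T) = Y})\<^sup>2 \<le> 12 ^ k" if Y: "Y \<in> Pow (I - ?T)" for Y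
  proof -
    let ?H = "{A\<in>G. A \<inter> (I - ?T) = Y}"
    have inj: "inj_on (\<lambda>A. (A \<inter> B1, A \<inter> B2)) ?H"
    proof (rule inj_onI)
      fix A B assume A: "A \<in> ?H" and B: "B \<in> ?H" and "(A \<inter> B1, A \<inter> B2) = (B \<inter> B1, B \<inter> B2)"
      then have "A \<inter> I = B \<inter> I" by blast
      then show "A = B" using A B recon by blast
    qed
    \<comment> \<open>With the trace \<open>Y\<close> outside the blocks fixed, its contribution to
      coordinate \<open>e\<close> is a constant of the section.\<close>
    have sect: "[ind A e = (\<Sum>i\<in>Y. g e i) + (\<Sum>i\<in>B1. g e i * ind A i) + (\<Sum>i\<in>B2. g e i * ind A i)] (mod p)"
      if A: "A \<in> ?H" and e: "e \<in> E" for A e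
    proof -
      have "(\<Sum>i\<in>I. ind A i * w i e) = (\<Sum>i\<in>I - ?T. g e i * ind A i) + (\<Sum>i\<in>?T. g e i * ind A i)"
        using sum.subset_diff[OF TI fI, of "\<lambda>i. g e i * ind A i"] by (simp add: g_def mult.commute)
      also have "(\<Sum>i\<in>?T. g e i * ind A i) = (\<Sum>i\<in>B1. g e i * ind A i) + (\<Sum>i\<in>B2. g e i * ind A i)"
        using fin pair by (intro sum.union_disjoint) auto
      also have "(\<Sum>i\<in>I - ?T. g e i * ind A i) = (\<Sum>i\<in>Y. g e i)"
        using A Y fI by (intro sum.mono_neutral_cong_right) (auto simp: ind_def)
      finally show ?thesis using rep[of A e] A e pair(1) by (auto simp: add.assoc)
    qed
    have "finite ?H" using assms(4) by simp
    then have "(card ?H)\<^sup>2 \<le> 2 ^ card E * 6 ^ card B1"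
      by (rule card_dual_pair_section[OF assms(2) _ fin(1-3) pair(6-8) inj sect])
    also have "\<dots> \<le> 2 ^ k * 6 ^ k"
      using pair(5) by (intro mult_mono) (auto simp: k_def intro: power_increasing)
    also have "\<dots> = 12 ^ k" by (simp flip: power_mult_distrib)
    finally show ?thesis .
  qed
  then have "(card G)\<^sup>2 \<le> (card (Pow (I - ?T)))\<^sup>2 * 12 ^ k"
    using assms(4) fI by (intro card_squared_le_fibres[where f = "\<lambda>A. A \<inter> (I - ?T)"]) auto
  also have "(card (Pow (I - ?T)))\<^sup>2 = 4 ^ card (I - ?T)"
    using fI by (simp add: card_Pow power2_eq_square flip: power_mult_distrib)
  \<comment> \<open>The factor \<open>16 ^ k\<close> makes up for the \<open>2 * k\<close> pivots
    missing from \<open>4 ^ card (I - ?T)\<close>.\<close>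
  finally have "16 ^ k * (card G)\<^sup>2 \<le> 16 ^ k * (4 ^ card (I - ?T) * 12 ^ k)" by simp
  also have "\<dots> = 4 ^ card I * 12 ^ k"
    by (simp add: cI power_add power_mult)
  finally have first: "16 ^ k * (card G)\<^sup>2 \<le> 4 ^ card I * 12 ^ k" .
  \<comment> \<open>by maximality, fixing the traces on \<open>B1 \<union> B2\<close> and \<open>E\<close> leaves every coordinate depending on one \<open>i0\<close>\<close>
  have "card G \<le> 8 ^ k * M" if M: "\<forall>H\<subseteq>G. determined N I H \<longrightarrow> card H \<le> M" for M
  proof -
    have "card {A\<in>G. (A \<inter> ?T, A \<inter> E) = s} \<le> M" for s
    proof -
      let ?H = "{A\<in>G. (A \<inter> ?T, A \<inter> E) = s}"
      have "determined N I ?H" unfolding determined_def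
      proof
        fix e assume e: "e \<in> N"
        obtain v i0 where v: "v \<in> int_span g E"
          and vj: "\<And>j. j \<in> I - ?T - {i0} \<Longrightarrow> [g e j = v j] (mod p)"
          using maximal[OF e] by blast
        obtain c where c: "v = (\<lambda>i. \<Sum>f\<in>E. c f * g f i)" using v unfolding int_span_def by blast
        have "e \<in> A \<longleftrightarrow> e \<in> B"
          if A: "A \<in> ?H" and B: "B \<in> ?H" and i0: "i0 \<in> I \<longrightarrow> (i0 \<in> A \<longleftrightarrow> i0 \<in> B)" for A B
        proof -
          \<comment> \<open>The difference of two members of a class vanishes on the blocks, on
            \<open>E\<close> and at \<open>i0\<close>. Elsewhere on \<open>I\<close> the row of
            \<open>e\<close> is a combination of the rows in \<open>E\<close>, so \<open>u e\<close>
            vanishes modulo \<open>p\<close> as well.\<close>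
          define u where "u i = ind A i - ind B i" for i
          have uT: "u i = 0" if "i \<in> ?T" for i using A B that by (auto simp: u_def ind_def)
          have u0: "u i0 = 0" if "i0 \<in> I" using i0 that by (simp add: u_def ind_def)
          have uE: "u f = 0" if "f \<in> E" for f using A B that by (auto simp: u_def ind_def)
          have urep: "[u f = (\<Sum>i\<in>I. u i * g f i)] (mod p)" if "f \<in> N" for f
            using cong_diff[OF rep[of A f] rep[of B f]] A B that
            by (simp add: u_def g_def left_diff_distrib sum_subtractf)
          have "[u e = (\<Sum>i\<in>I. u i * g e i)] (mod p)" using urep e by blast
          also have "[(\<Sum>i\<in>I. u i * g e i) = (\<Sum>i\<in>I. u i * v i)] (mod p)"
          proof (rule cong_sum)
            fix i assume i: "i \<in> I"
            show "[u i * g e i = u i * v i] (mod p)"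
            proof (cases "u i = 0")
              case False
              then have "i \<in> I - ?T - {i0}" using i uT u0 by blast
              then show ?thesis using vj cong_scalar_left by blast
            qed simp
          qed
          also have "(\<Sum>i\<in>I. u i * v i) = (\<Sum>f\<in>E. c f * (\<Sum>i\<in>I. u i * g f i))"
            unfolding c sum_distrib_left by (subst sum.swap) (simp add: mult_ac)
          also have "[(\<Sum>f\<in>E. c f * (\<Sum>i\<in>I. u i * g f i)) = (\<Sum>f\<in>E. c f * u f)] (mod p)"
          proof (rule cong_sum, rule cong_scalar_left)
            fix f assume "f \<in> E"
            then show "[(\<Sum>i\<in>I. u i * g f i) = u f] (mod p)"
              using urep pair(1) by (blast intro: cong_sym)
          qed
          also have "(\<Sum>f\<in>E. c f * u f) = 0" using uE by simp
          finally have "[ind A e = ind B e] (mod p)"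
            unfolding u_def cong_diff_iff_cong_0 .
          then show ?thesis using ind_cong_imp_eq[of p] assms(2) by simp
        qed
        then show "\<exists>i. \<forall>A\<in>?H. \<forall>B\<in>?H. (i \<in> I \<longrightarrow> (i \<in> A \<longleftrightarrow> i \<in> B)) \<longrightarrow> (e \<in> A \<longleftrightarrow> e \<in> B)"
          by (intro exI[of _ i0] ballI impI)
      qed
      moreover have "?H \<subseteq> G" by blast
      ultimately show ?thesis using M by blast
    qed
    then have "card G \<le> card (Pow ?T \<times> Pow E) * M"
      using assms(4) fin by (intro card_le_fibres[where f = "\<lambda>A. (A \<inter> ?T, A \<inter> E)"]) auto
    also have "card (Pow ?T \<times> Pow E) \<le> 2 ^ (2 * k) * 2 ^ k"
      using fin pair(5) cT by (simp add: card_cartesian_product card_Pow k_def)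
    also have "(2::nat) ^ (2 * k) * 2 ^ k = 8 ^ k"
      by (simp add: power_mult flip: power_mult_distrib)
    finally show ?thesis by simp
  qed
  with first show ?thesis by blast
qed

text \<open>The numerical input is \<open>8 * (3/4)^8 < 1\<close>, which eliminates \<open>k\<close> from the two bounds.\<close>
lemma card_power17_bound:
  fixes a d k M :: nat
  assumes "16 ^ k * a\<^sup>2 \<le> 4 ^ d * 12 ^ k" "a \<le> 8 ^ k * M"
  shows "a ^ 17 \<le> 2 ^ (16 * d) * M"
proof -
  \<comment> \<open>Of the 17 factors \<open>a\<close>, 16 are bounded by eight copies of the first
    hypothesis and the last by the second.\<close>
  have "(16 ^ k * a\<^sup>2) ^ 8 \<le> (4 ^ d * 12 ^ k) ^ 8" using assms(1) by (rule power_mono) simp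
  moreover have "(x ^ k) ^ 8 = (x ^ 8) ^ k" for x :: nat
    by (simp only: power_mult[symmetric] mult.commute)
  moreover have "((4::nat) ^ d) ^ 8 = 2 ^ (16 * d)"
  proof -
    have "(4::nat) ^ d = 2 ^ (2 * d)" by (simp add: power_mult)
    then show ?thesis by (simp flip: power_mult)
  qed
  moreover have "(a\<^sup>2) ^ 8 = a ^ 16" by (simp flip: power_mult)
  ultimately have "(16 ^ 8) ^ k * a ^ 16 \<le> 2 ^ (16 * d) * (12 ^ 8) ^ k"
    by (simp only: power_mult_distrib)
  moreover have "(2::nat) ^ (16 * d) * (12 ^ 8) ^ k * 8 ^ k \<le> 2 ^ (16 * d) * (16 ^ 8) ^ k"
  proof -
    have "((12::nat) ^ 8) ^ k * 8 ^ k = (12 ^ 8 * 8) ^ k" by (simp only: power_mult_distrib)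
    also have "\<dots> \<le> (16 ^ 8) ^ k" by (rule power_mono) simp_all
    finally show ?thesis by (simp only: mult.assoc mult_le_mono2)
  qed
  ultimately have "(16 ^ 8) ^ k * a ^ 16 * 8 ^ k \<le> 2 ^ (16 * d) * (16 ^ 8) ^ k"
    by (meson le_trans mult_le_mono1)
  then have "(16 ^ 8) ^ k * (a ^ 16 * 8 ^ k) \<le> (16 ^ 8) ^ k * 2 ^ (16 * d)"
    by (simp only: mult_ac)
  then have le: "a ^ 16 * 8 ^ k \<le> 2 ^ (16 * d)" by (subst (asm) mult_le_cancel1) simp
  have "a ^ 17 = a ^ 16 * a" by (simp add: eval_nat_numeral)
  also have "\<dots> \<le> a ^ 16 * (8 ^ k * M)" using assms(2) by (rule mult_le_mono2)
  also have "\<dots> \<le> 2 ^ (16 * d) * M" using mult_le_mono1[OF le, of M] by (simp only: mult.assoc)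
  finally show ?thesis .
qed

section \<open>Combining the primes\<close>

definition odd_part :: "nat \<Rightarrow> nat \<Rightarrow> nat set set \<Rightarrow> nat set set" where
  "odd_part l p F = {A\<in>F. \<not> p ^ multiplicity p l dvd card A}"

lemma oddtown_finite:
  assumes "oddtown l n F"
  shows "finite F" "\<And>A. A \<in> F \<Longrightarrow> A \<subseteq> {1..n}"
proof -
  show "A \<subseteq> {1..n}" if "A \<in> F" for A using that assms by (auto simp: oddtown_def)
  then have "F \<subseteq> Pow {1..n}" by blast
  then show "finite F" using finite_subset by blast
qed

lemma oddtown_eq_Union_odd_part:
  assumes "l > 0" "oddtown l n F"
  shows "F = (\<Union>p\<in>prime_factors l. odd_part l p F)"
proof -
  have "\<exists>p\<in>prime_factors l. A \<in> odd_part l p F" if A: "A \<in> F" for A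
  proof (rule ccontr)
    assume neg: "\<not> ?thesis"
    have ndvd: "\<not> l dvd card A" using A assms(2) by (auto simp: oddtown_def dvd_eq_mod_eq_0)
    then have nz: "card A \<noteq> 0" by (metis dvd_0_right)
    have "multiplicity p l \<le> multiplicity p (card A)" if p: "prime p" for p
    proof (cases "p \<in> prime_factors l")
      case True
      then have "p ^ multiplicity p l dvd card A"
        using neg A by (auto simp: odd_part_def)
      then show ?thesis using nz p by (intro multiplicity_geI) (auto dest: not_prime_unit)
    next
      case False
      then have "multiplicity p l = 0"
        using p assms(1) by (auto simp: prime_factors_multiplicity)
      then show ?thesis by simp
    qed
    then have "l dvd card A" using assms(1) nz by (intro multiplicity_le_imp_dvd) auto
    with ndvd show False by blast
  qed
  then show ?thesis by (auto simp: odd_part_def)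
qed

lemma of_nat_ppow_dvd_iff: "int p ^ a dvd int m \<longleftrightarrow> p ^ a dvd m"
  by (metis int_dvd_int_iff of_nat_power)

lemma ppow_oddtown_odd_part:
  assumes "oddtown l n F"
  shows "ppow_oddtown (int p ^ multiplicity p l) (odd_part l p F)"
  unfolding ppow_oddtown_def of_nat_ppow_dvd_iff
proof (intro conjI ballI impI)
  fix A B assume "A \<in> odd_part l p F" "B \<in> odd_part l p F" "A \<noteq> B"
  then have "l dvd card (A \<inter> B)"
    using assms by (auto simp: oddtown_def odd_part_def dvd_eq_mod_eq_0)
  then show "p ^ multiplicity p l dvd card (A \<inter> B)" by (rule dvd_trans[OF multiplicity_dvd])
qed (simp add: odd_part_def)

text \<open>\<open>d\<close> is the rank modulo \<open>p\<close> of the sets outside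
  \<open>odd_part l p F\<close>. These are orthogonal modulo \<open>p ^ multiplicity p l\<close> to
  themselves and to the odd part, and are injected into \<open>Pow I\<close> by their
  traces.\<close>

lemma oddtown_prime_bound:
  assumes l: "l > 0" and F: "oddtown l n F" and p: "p \<in> prime_factors l"
  shows "\<exists>d. card (odd_part l p F) + 2 * d \<le> n \<and> card (F - odd_part l p F) \<le> 2 ^ d \<and>
    (odd p \<longrightarrow> card (F - odd_part l p F) ^ 17 \<le> 2 ^ (16 * d) * (card (prime_factors l) * (d + 1)))"
proof -
  define q where "q = int p ^ multiplicity p l"
  define G where "G = F - odd_part l p F"
  let ?N = "{1..n}" and ?P = "int p"
  have pp: "prime ?P" using p by auto
  have p1: "?P > 1" using pp prime_gt_1_int by blast
  have m: "multiplicity p l > 0"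
    using p l by (simp add: prime_factors_multiplicity)
  have fF: "finite F" and sub: "\<And>A. A \<in> F \<Longrightarrow> A \<subseteq> ?N" using oddtown_finite[OF F] by auto
  have fG: "finite G" and subG: "\<And>A. A \<in> G \<Longrightarrow> A \<subseteq> ?N" using fF sub by (auto simp: G_def)
  have oF: "odd_part l p F \<subseteq> F" by (auto simp: odd_part_def)
  obtain I r where IN: "I \<subseteq> ?N" and dual: "dual_system ?P ind G I r"
    and rep: "\<And>A e. A \<in> G \<Longrightarrow> e \<in> ?N \<Longrightarrow> [ind A e = (\<Sum>i\<in>I. ind A i * r i e)] (mod ?P)"
    using exists_spanning_dual_system[OF pp fG, of ?N ind] by (metis finite_atLeastAtMost)
  have fI: "finite I" using IN finite_subset by blast
  define d where "d = card I"
  have orth: "q dvd int (card (A \<inter> B))" if A: "A \<in> G" and B: "B \<in> odd_part l p F \<union> G" for A B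
  proof -
    have "p ^ multiplicity p l dvd card (A \<inter> B)"
    proof (cases "A = B")
      case True
      then show ?thesis using A by (simp add: G_def odd_part_def)
    next
      case False
      moreover have "A \<in> F" "B \<in> F" using A B oF by (auto simp: G_def)
      ultimately have "l dvd card (A \<inter> B)"
        using F unfolding oddtown_def dvd_eq_mod_eq_0 by blast
      then show ?thesis by (rule dvd_trans[OF multiplicity_dvd])
    qed
    then show ?thesis unfolding q_def of_nat_ppow_dvd_iff .
  qed
  have "card (odd_part l p F) + 2 * card I \<le> card ?N"
    using fF fG oF subG sub orth m ppow_oddtown_odd_part[OF F] IN dual finite_subset[OF oF]
    by (intro card_ppow_oddtown_rank[OF pp, of ?N _ G "multiplicity p l"]) (auto simp: q_def)
  then have b1: "card (odd_part l p F) + 2 * d \<le> n" by (simp add: d_def)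
  have "inj_on (\<lambda>A. A \<inter> I) G"
  proof (rule inj_onI)
    fix A B assume A: "A \<in> G" and B: "B \<in> G" and eq: "A \<inter> I = B \<inter> I"
    show "A = B"
      by (rule spanned_inter_eq_imp_eq[OF p1 subG[OF A] subG[OF B] rep[OF A] rep[OF B] eq])
  qed
  then have "card G \<le> card (Pow I)" using fI by (intro card_inj_on_le[of "\<lambda>A. A \<inter> I"]) auto
  then have b2: "card G \<le> 2 ^ d" using fI by (simp add: card_Pow d_def)
  have b3: "card G ^ 17 \<le> 2 ^ (16 * d) * (card (prime_factors l) * (d + 1))" if "odd p"
  proof -
    have p2: "?P > 2" using that p1 by (cases "p = 2") auto
    \<comment> \<open>The notion \<open>determined\<close> does not mention \<open>p\<close>, so it
      can be exploited modulo any prime \<open>s\<close> of \<open>l\<close>: each member of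
      \<open>H\<close> is odd for some \<open>s\<close>, and the affine bound applies to each odd
      part.\<close>
    have "card H \<le> card (prime_factors l) * (d + 1)" if H: "H \<subseteq> G" and det: "determined ?N I H" for H
    proof -
      have fH: "finite H" using H fG finite_subset by blast
      have "H \<subseteq> (\<Union>s\<in>prime_factors l. H \<inter> odd_part l s F)"
        using oddtown_eq_Union_odd_part[OF l F] H unfolding G_def by blast
      then have "card H \<le> card (\<Union>s\<in>prime_factors l. H \<inter> odd_part l s F)"
        using fH by (intro card_mono) auto
      also have "\<dots> \<le> (\<Sum>s\<in>prime_factors l. card (H \<inter> odd_part l s F))"
        by (rule card_UN_le) simp
      also have "\<dots> \<le> (\<Sum>s\<in>prime_factors l. d + 1)"
      proof (rule sum_mono)
        fix s assume s: "s \<in> prime_factors l"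
        have pw: "ppow_oddtown (int s ^ multiplicity s l) (H \<inter> odd_part l s F)"
          using ppow_oddtown_odd_part[OF F, of s] by (auto simp: ppow_oddtown_def)
        have ps: "prime (int s)" using s by auto
        have subH: "A \<subseteq> ?N" if "A \<in> H \<inter> odd_part l s F" for A using H subG that by blast
        have det': "determined ?N I (H \<inter> odd_part l s F)"
          using det unfolding determined_def by (meson IntD1)
        have "finite (H \<inter> odd_part l s F)" using fH by simp
        then show "card (H \<inter> odd_part l s F) \<le> d + 1" unfolding d_def
          by (rule card_affine_ppow_oddtown[OF ps finite_atLeastAtMost fI _ subH pw det'])
      qed
      finally show ?thesis by simp
    qed
    moreover obtain k where "16 ^ k * (card G)\<^sup>2 \<le> 4 ^ card I * 12 ^ k"
      "\<And>M. (\<forall>H\<subseteq>G. determined ?N I H \<longrightarrow> card H \<le> M) \<Longrightarrow> card G \<le> 8 ^ k * M"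
      using maximal_dual_pair_bounds[OF pp p2 finite_atLeastAtMost fG subG IN rep] by blast
    ultimately show ?thesis unfolding d_def by (intro card_power17_bound[of k]) blast+
  qed
  from b1 b2 b3 show ?thesis unfolding G_def by blast
qed

lemma f_odd_attained:
  assumes "l > 0"
  obtains F where "oddtown l n F" "f_odd l n = card F"
proof -
  let ?S = "{card F | F. oddtown l n F}"
  have "?S \<subseteq> card ` Pow (Pow {1..n})" by (auto simp: oddtown_def)
  then have "finite ?S" by (rule finite_subset) simp
  moreover have "oddtown l n {}" by (simp add: oddtown_def)
  then have "?S \<noteq> {}" by blast
  ultimately have "Max ?S \<in> ?S" by (rule Max_in)
  then show thesis using that unfolding f_odd_def by blast
qed

section \<open>Logarithmic estimates for large \<open>n\<close>\<close>

lemma rank_lower_bound_even: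
  fixes n a d :: nat
  assumes "real n / 2 \<le> real a" "n > 0" "a \<le> 2 ^ d"
  shows "log 2 n - 1 \<le> d"
proof -
  have "real a \<le> 2 ^ d" using assms(3) by (metis of_nat_le_iff of_nat_numeral of_nat_power)
  then have "real n / 2 \<le> 2 ^ d" using assms(1) by linarith
  then have "log 2 (real n / 2) \<le> log 2 (2 ^ d)"
    using assms(2) by (subst log_le_cancel_iff) auto
  then show ?thesis using assms(2) by (simp add: log_divide)
qed

text \<open>Taking logarithms, with \<open>L = log 2 n\<close>, gives \<open>17 * (L - 1)\<close> at
  most \<open>16 * d\<close> plus lower order terms; these and the 17 fit into \<open>L / 2\<close>,
  so \<open>16 * d \<ge> 33 * L / 2\<close>. The split at \<open>2 * L\<close> serves to bound
  \<open>log 2 (d + 1)\<close>.\<close>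

lemma rank_lower_bound_odd:
  fixes n a d \<omega> :: nat
  assumes "real n / 2 \<le> real a" "n > 0" "\<omega> > 0" "a ^ 17 \<le> 2 ^ (16 * d) * (\<omega> * (d + 1))"
    and small: "17 + log 2 \<omega> + log 2 (2 * log 2 n + 1) \<le> log 2 n / 2" and L: "log 2 n \<ge> 0"
  shows "2 * log 2 n + log 2 n / 16 \<le> 2 * d"
proof (cases "real d \<ge> 2 * log 2 n")
  case True
  then show ?thesis using L by linarith
next
  case False
  have a: "real a > 0" using assms(1,2) by linarith
  have "real (a ^ 17) \<le> real (2 ^ (16 * d) * (\<omega> * (d + 1)))" using assms(4) by (simp only: of_nat_le_iff)
  also have "real (2 ^ (16 * d) * (\<omega> * (d + 1))) = 2 ^ (16 * d) * (real \<omega> * (real d + 1))"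
    by (simp add: algebra_simps)
  finally have le: "real a ^ 17 \<le> 2 ^ (16 * d) * (real \<omega> * (real d + 1))" by simp
  have "log 2 (real a ^ 17) \<le> log 2 (2 ^ (16 * d) * (real \<omega> * (real d + 1)))"
    by (rule log_mono[OF _ _ le]) (use a in auto)
  also have "\<dots> = 16 * real d + (log 2 \<omega> + log 2 (real d + 1))"
    using assms(3) by (simp add: log_mult)
  also have "log 2 (real d + 1) \<le> log 2 (2 * log 2 n + 1)"
    using False by (intro log_mono) auto
  finally have 1: "17 * log 2 a \<le> 16 * real d + (log 2 \<omega> + log 2 (2 * log 2 n + 1))"
    using a by (simp add: log_nat_power)
  have "log 2 (real n / 2) \<le> log 2 a" using assms(1,2) by (intro log_mono) auto
  then have "log 2 n - 1 \<le> log 2 a" using assms(2) by (simp add: log_divide)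
  with 1 small show ?thesis by linarith
qed

lemma eventually_log_bounds:
  fixes c \<omega> K :: real
  assumes "c > 0"
  shows "eventually (\<lambda>n::nat. n > 0 \<and> log 2 n \<ge> K \<and> c * log 2 n \<le> n / 2 \<and>
    17 + \<omega> + log 2 (2 * log 2 n + 1) \<le> log 2 n / 2) sequentially"
proof -
  have L: "filterlim (\<lambda>n::nat. log 2 (real n)) at_top sequentially" by real_asymp
  have "filterlim (\<lambda>x::real. x / 2 - log 2 (2 * x + 1)) at_top at_top" by real_asymp
  then have "eventually (\<lambda>x. x / 2 - log 2 (2 * x + 1) \<ge> 17 + \<omega>) at_top"
    by (simp add: filterlim_at_top)
  then have e1: "eventually (\<lambda>n::nat. log 2 n / 2 - log 2 (2 * log 2 n + 1) \<ge> 17 + \<omega>) sequentially"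
    using L by (rule eventually_compose_filterlim)
  have e2: "eventually (\<lambda>n::nat. log 2 n \<ge> K) sequentially" using L by (simp add: filterlim_at_top)
  have "((\<lambda>n::nat. log 2 n / n) \<longlongrightarrow> 0) sequentially" by real_asymp
  then have e3: "eventually (\<lambda>n::nat. log 2 n / n < 1 / (2 * c)) sequentially"
    using assms by (intro order_tendstoD) auto
  show ?thesis
    using e1 e2 e3 eventually_gt_at_top[of 0]
  proof eventually_elim
    case (elim n)
    then show ?case using assms by (auto simp: field_simps)
  qed
qed

theorem theorem1p2:
  fixes l :: nat
  assumes "l > 0"
    and "card {p. prime p \<and> odd p \<and> p dvd l} \<ge> 2"
  shows "\<exists>n0. \<forall>n\<ge>n0.
     real (f_odd l n) \<le>
       real (card (prime_factors l)) * real n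
       - (2 * real (card (prime_factors l))
          + (1/20) * (\<Sum>p\<in>P_odd_star l. 1 / (real p)^2)) * log 2 (real n)"
proof -
  let ?W = "prime_factors l"
  let ?O = "{p. prime p \<and> odd p \<and> p dvd l}"
  define \<omega> where "\<omega> = card ?W"
  define \<epsilon> where "\<epsilon> = (1/20) * (\<Sum>p\<in>P_odd_star l. 1 / (real p)^2)"
  have OW: "?O \<subseteq> ?W" using assms(1) by (auto simp: prime_factors_dvd)
  have fO: "finite ?O" using OW finite_subset by blast
  have \<omega>2: "\<omega> \<ge> 2" unfolding \<omega>_def using card_mono[OF _ OW] assms(2) by simp
  have \<epsilon>0: "\<epsilon> \<ge> 0" by (simp add: \<epsilon>_def sum_nonneg)
  \<comment> \<open>A crude bound suffices: each odd prime will gain \<open>L / 16\<close>, so it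
    can pay for \<open>L / 20\<close>.\<close>
  have "(\<Sum>p\<in>P_odd_star l. 1 / (real p)^2) \<le> (\<Sum>p\<in>P_odd_star l. 1)"
  proof (rule sum_mono)
    fix p assume "p \<in> P_odd_star l"
    then have "real p \<ge> 1" by (simp add: P_odd_star_def prime_gt_0_nat Suc_leI)
    then show "1 / (real p)^2 \<le> 1" by simp
  qed
  also have "\<dots> \<le> real (card ?O)"
    using fO by (simp add: P_odd_star_def card_Diff1_le)
  finally have \<epsilon>_le: "\<epsilon> \<le> real (card ?O) / 20" by (simp add: \<epsilon>_def)
  define c where "c = 2 * real \<omega> + \<epsilon>"
  have "c > 0" using \<omega>2 \<epsilon>0 by (simp add: c_def)
  from eventually_log_bounds[OF this, of "max 1 (80 * real \<omega>)" "log 2 \<omega>"]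
  obtain n0 :: nat where n0: "\<And>n::nat. n \<ge> n0 \<Longrightarrow> n > 0 \<and> log 2 n \<ge> max 1 (80 * real \<omega>) \<and> c * log 2 n \<le> n / 2 \<and>
    17 + log 2 \<omega> + log 2 (2 * log 2 n + 1) \<le> log 2 n / 2"
    unfolding eventually_sequentially by auto
  have "real (f_odd l n) \<le> real \<omega> * real n - c * log 2 (real n)" if "n \<ge> n0" for n
  proof (rule ccontr)
    assume neg: "\<not> ?thesis"
    define L where "L = log 2 n"
    have n: "n > 0" "L \<ge> 1" "L \<ge> 80 * \<omega>" "c * L \<le> n / 2"
      "17 + log 2 \<omega> + log 2 (2 * L + 1) \<le> L / 2"
      using n0[OF that, folded L_def] by auto
    obtain F where F: "oddtown l n F" and fF: "f_odd l n = card F"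
      using f_odd_attained[OF assms(1)] by blast
    have big: "real (card F) > real \<omega> * real n - c * L" using neg fF by (simp add: L_def)
    have finF: "finite F" using oddtown_finite[OF F] by blast
    have "\<exists>d. real (card (odd_part l p F)) + 2 * real d \<le> n \<and>
        2 * L - 2 + (if odd p then L / 16 else 0) \<le> 2 * real d" if p: "p \<in> ?W" for p
    proof -
      let ?G = "F - odd_part l p F"
      obtain d where d: "card (odd_part l p F) + 2 * d \<le> n" "card ?G \<le> 2 ^ d"
        "odd p \<Longrightarrow> card ?G ^ 17 \<le> 2 ^ (16 * d) * (\<omega> * (d + 1))"
        using oddtown_prime_bound[OF assms(1) F p] unfolding \<omega>_def by blast
      have "real (card ?G) \<ge> real (card F) - real (card (odd_part l p F))"
        using diff_card_le_card_Diff[of "odd_part l p F" F] finF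
        by (simp add: odd_part_def)
      moreover have "real (card (odd_part l p F)) \<le> n" using d(1) by simp
      moreover have "2 * real n \<le> \<omega> * real n" using \<omega>2 by (intro mult_right_mono) auto
      \<comment> \<open>The family has more than \<open>\<omega> * n - n / 2 \<ge> 3 * n / 2\<close>
        sets, and one odd part holds at most \<open>n\<close> of them.\<close>
      ultimately have G: "real n / 2 \<le> card ?G" using big n(4) by linarith
      have "2 * L - 2 + (if odd p then L / 16 else 0) \<le> 2 * real d"
      proof (cases "odd p")
        case True
        then show ?thesis
          using rank_lower_bound_odd[OF G n(1) _ d(3)] n \<omega>2 by (simp add: L_def)
      next
        case False
        then show ?thesis using rank_lower_bound_even[OF G n(1) d(2)] by (simp add: L_def)
      qed
      moreover have "real (card (odd_part l p F) + 2 * d) \<le> real n" using d(1) by (simp only: of_nat_le_iff)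
      ultimately show ?thesis by auto
    qed
    then have part: "real (card (odd_part l p F)) \<le> n - (2 * L - 2) - (if odd p then L / 16 else 0)"
      if "p \<in> ?W" for p using that by (smt (verit))
    have "card F \<le> (\<Sum>p\<in>?W. card (odd_part l p F))"
      using card_UN_le[of ?W "\<lambda>p. odd_part l p F"] oddtown_eq_Union_odd_part[OF assms(1) F] by simp
    then have "real (card F) \<le> real (\<Sum>p\<in>?W. card (odd_part l p F))" by (simp only: of_nat_le_iff)
    also have "\<dots> = (\<Sum>p\<in>?W. real (card (odd_part l p F)))" by simp
    also have "\<dots> \<le> (\<Sum>p\<in>?W. real n - (2 * L - 2) - (if odd p then L / 16 else 0))"
      using part by (rule sum_mono)
    also have "\<dots> = real \<omega> * (real n - (2 * L - 2)) - (\<Sum>p\<in>?W. if odd p then L / 16 else 0)"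
      by (simp add: sum_subtractf \<omega>_def)
    also have "(\<Sum>p\<in>?W. if odd p then L / 16 else 0) = real (card ?O) * (L / 16)"
    proof -
      have "{p\<in>?W. odd p} = ?O" using assms(1) by (auto simp: prime_factors_dvd)
      then show ?thesis by (simp add: sum.If_cases Int_def)
    qed
    finally have le: "real (card F) \<le> real \<omega> * (real n - (2 * L - 2)) - real (card ?O) * (L / 16)" .
    \<comment> \<open>Each odd prime leaves a surplus of \<open>L / 16 - L / 20 = L / 80\<close>.
      Two odd primes and \<open>L \<ge> 80 * \<omega>\<close> thus absorb the rounding loss
      \<open>2 * \<omega>\<close> that comes from \<open>2 * L - 2\<close>.\<close>
    have "\<epsilon> * L \<le> real (card ?O) / 20 * L" using \<epsilon>_le n(2) by (intro mult_right_mono) auto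
    moreover have "2 * (L / 80) \<le> real (card ?O) * (L / 80)"
      using assms(2) n(2) by (intro mult_right_mono) auto
    ultimately show False using le big n(3) by (simp add: c_def algebra_simps)
  qed
  then show ?thesis unfolding c_def \<epsilon>_def \<omega>_def by blast
qed

end
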